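(* Let $X$ be a two-sided quaternionic Banach space, let $T\in\mathcal{B}_R(X)$ and let $i\in\mathbb{S}$ be fixed. Let $D$ be a bounded slice Cauchy domain such that $\sigma_S(T)\subset D$, and let $f$ be an intrinsic slice hyperholomorphic function whose domain $\mathcal{D}(f)$ satisfies $\overline{D}\subset\mathcal{D}(f)$. Put $D_i=D\cap\mathbb{C}_i$ and $f_i=f|_{\mathcal{D}(f)\cap\mathbb{C}_i}$. Then $$\frac{1}{2\pi}\int_{\partial D_i}S_L^{-1}(s,T)\,ds_i\,f(s)=\frac{1}{2\pi i}\int_{\partial D_i}\Delta_s^{-1}f(s)\,ds.$$ That is, $f(T)=f_i(T_i)$, where $f(T)$ is given by the S-functional calculus (left-hand side) and $f_i(T_i)$ by the Riesz–Dunford functional calculus of the complex linear operator $T_i$ (right-hand side).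
   Context: $\mathbb{H}$ denotes the quaternions, $\mathbb{S}=\{q\in\mathbb{H}:q^2=-1\}$, $\mathbb{C}_j=\{\alpha+\beta j:\alpha,\beta\in\mathbb{R}\}$ for $j\in\mathbb{S}$, and $[q]=\{\mathrm{Re}(q)+|\mathrm{Im}(q)|j: j\in\mathbb{S}\}$. A set $U\subseteq\mathbb{H}$ is axially symmetric if $[q]\subset U$ for all $q\in U$. A two-sided quaternionic Banach space $X$ is an abelian group which is both a left and a right $\mathbb{H}$-vector space, with $rx=xr$ for $r\in\mathbb{R}$ and $(px)q=p(xq)$ for $p,q\in\mathbb{H}$, complete for a norm with $\|qx\|=\|xq\|=|q|\,\|x\|$. $\mathcal{B}_R(X)$ is the set of bounded right $\mathbb{H}$-linear operators on $X$; it carries left and right quaternionic multiplications $(qT)x=q(Tx)$ and $(Tq)x=T(qx)$. $Q_q(T)=T^2-2\mathrm{Re}(q)T+|q|^2I$; $\rho_S(T)=\{q\in\mathbb{H}:Q_q(T)\text{ is invertible in }\mathcal{B}_R(X)\}$ and $\sigma_S(T)=\mathbb{H}\setminus\rho_S(T)$. For $s\in\rho_S(T)$ the left S-resolvent is $S_L^{-1}(s,T)=-Q_s(T)^{-1}(T-\bar sI)$. In the left-hand integral, $ds_i=ds/i=-i\,ds$, and quaternions multiply operators via the right multiplication $(Tq)x=T(qx)$. Identify $\mathbb{C}_i$ with $\mathbb{C}$; $X_i$ is $X$ viewed as a complex Banach space via right multiplication by $\mathbb{C}_i$, and $T_i$ is $T$ viewed as a complex linear operator on $X_i$. $\Delta_s=R_s-T$,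 where $R_sx=xs$; for $s\in\rho_S(T)\cap\mathbb{C}_i$, $\Delta_s^{-1}$ is the resolvent $(sI-T_i)^{-1}$ of $T_i$. The right-hand integral is taken in $\mathcal{B}(X_i)$, scalars in $\mathbb{C}_i$ acting by the complex structure of $X_i$ (i.e. by right multiplication on vectors). Slice hyperholomorphic functions: let $U\subseteq\mathbb{H}$ be an axially symmetric open set and $\mathcal{U}=\{(\alpha,\beta)\in\mathbb{R}^2:\alpha+\beta\mathbb{S}\subset U\}$. $f:U\to\mathbb{H}$ is left slice hyperholomorphic if there are (continuously differentiable) $f_0,f_1:\mathcal{U}\to\mathbb{H}$ with $f(\alpha+\beta j)=f_0(\alpha,\beta)+jf_1(\alpha,\beta)$ for all $\alpha+\beta j\in U$ ($j\in\mathbb{S}$), with $f_0(\alpha,-\beta)=f_0(\alpha,\beta)$, $f_1(\alpha,-\beta)=-f_1(\alpha,\beta)$, and $\partial_\alpha f_0-\partial_\beta f_1=0$, $\partial_\beta f_0+\partial_\alpha f_1=0$. It is right slice hyperholomorphic if the same holds with $f(\alpha+\beta j)=f_0(\alpha,\beta)+f_1(\alpha,\beta)j$. It is intrinsic if moreover $f_0,f_1$ are real-valued. A slice Cauchy domain is an axially symmetric open set $D\subset\mathbb{H}$ such that for every $j\in\mathbb{S}$, $\partial(D\cap\mathbb{C}_j)$ is the union of finitely many nonintersecting piecewise continuously differentiable Jordan curves in $\mathbb{C}_j$; $\partial D_i$ is positively oriented. *)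

theory Defs
  imports "HOL-Complex_Analysis.Complex_Analysis"
begin

section \<open>Quaternions\<close>

datatype quat = Quat (qRe: real) (qIm1: real) (qIm2: real) (qIm3: real)

lemma quat_eq_iff:
  "p = q \<longleftrightarrow> qRe p = qRe q \<and> qIm1 p = qIm1 q \<and> qIm2 p = qIm2 q \<and> qIm3 p = qIm3 q"
  by (cases p; cases q) auto

instantiation quat :: real_div_algebra
begin

definition "0 = Quat 0 0 0 0"
definition "1 = Quat 1 0 0 0"
definition "p + q = Quat (qRe p + qRe q) (qIm1 p + qIm1 q) (qIm2 p + qIm2 q) (qIm3 p + qIm3 q)"
definition "- q = Quat (- qRe q) (- qIm1 q) (- qIm2 q) (- qIm3 q)"
definition "p - q = Quat (qRe p - qRe q) (qIm1 p - qIm1 q) (qIm2 p - qIm2 q) (qIm3 p - qIm3 q)"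
definition "r *\<^sub>R q = Quat (r * qRe q) (r * qIm1 q) (r * qIm2 q) (r * qIm3 q)"
definition "p * q = Quat
  (qRe p * qRe q - qIm1 p * qIm1 q - qIm2 p * qIm2 q - qIm3 p * qIm3 q)
  (qRe p * qIm1 q + qIm1 p * qRe q + qIm2 p * qIm3 q - qIm3 p * qIm2 q)
  (qRe p * qIm2 q - qIm1 p * qIm3 q + qIm2 p * qRe q + qIm3 p * qIm1 q)
  (qRe p * qIm3 q + qIm1 p * qIm2 q - qIm2 p * qIm1 q + qIm3 p * qRe q)"
definition "inverse q = (let n = (qRe q)\<^sup>2 + (qIm1 q)\<^sup>2 + (qIm2 q)\<^sup>2 + (qIm3 q)\<^sup>2
  in Quat (qRe q / n) (- qIm1 q / n) (- qIm2 q / n) (- qIm3 q / n))"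
definition "(p :: quat) div q = p * inverse q"

lemmas quat_defs = zero_quat_def one_quat_def plus_quat_def uminus_quat_def minus_quat_def
  scaleR_quat_def times_quat_def

instance
proof
  fix a b c :: quat and r s :: real
  show "a + b + c = a + (b + c)" "a + b = b + a" "0 + a = a" "- a + a = 0" "a - b = a + - b"
    "r *\<^sub>R (a + b) = r *\<^sub>R a + r *\<^sub>R b" "(r + s) *\<^sub>R a = r *\<^sub>R a + s *\<^sub>R a"
    "r *\<^sub>R s *\<^sub>R a = (r * s) *\<^sub>R a" "1 *\<^sub>R a = a"
    "a * b * c = a * (b * c)" "(a + b) * c = a * c + b * c" "a * (b + c) = a * b + a * c"
    "r *\<^sub>R a * b = r *\<^sub>R (a * b)" "a * r *\<^sub>R b = r *\<^sub>R (a * b)"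
    "1 * a = a" "a * 1 = a" "(0 :: quat) \<noteq> 1"
    by (simp_all add: quat_defs quat_eq_iff algebra_simps)
  show "inverse (0 :: quat) = 0" by (simp add: inverse_quat_def quat_defs)
  show "a div b = a * inverse b" by (rule divide_quat_def)
  assume "a \<noteq> 0"
  define n where "n = (qRe a)\<^sup>2 + (qIm1 a)\<^sup>2 + (qIm2 a)\<^sup>2 + (qIm3 a)\<^sup>2"
  have "n \<noteq> 0" using \<open>a \<noteq> 0\<close>
    by (simp add: n_def quat_defs quat_eq_iff add_nonneg_eq_0_iff)
  have s: "qRe a * qRe a + qIm1 a * qIm1 a + qIm2 a * qIm2 a + qIm3 a * qIm3 a = n"
    by (simp add: n_def power2_eq_square)
  show "inverse a * a = 1" "a * inverse a = 1"
    unfolding inverse_quat_def Let_def n_def [symmetric]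
    using s \<open>n \<noteq> 0\<close>
    by (simp_all add: times_quat_def one_quat_def quat_eq_iff field_simps)
qed

end

instantiation quat :: real_normed_div_algebra
begin

definition "norm q = sqrt ((qRe q)\<^sup>2 + (qIm1 q)\<^sup>2 + (qIm2 q)\<^sup>2 + (qIm3 q)\<^sup>2)"
definition "sgn (q :: quat) = q /\<^sub>R norm q"
definition "dist (p :: quat) q = norm (p - q)"
definition [code del]: "(uniformity :: (quat \<times> quat) filter) =
  (INF e\<in>{0 <..}. principal {(x, y). dist x y < e})"
definition [code del]: "open (U :: quat set) \<longleftrightarrow>
  (\<forall>x\<in>U. eventually (\<lambda>(x', y). x' = x \<longrightarrow> y \<in> U) uniformity)"

instance
proof
  fix a b :: quat and r :: real and U :: "quat set"
  show "dist a b = norm (a - b)" by (rule dist_quat_def)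
  show "sgn a = a /\<^sub>R norm a" by (rule sgn_quat_def)
  show "(uniformity :: (quat \<times> quat) filter) =
      (INF e\<in>{0 <..}. principal {(x, y). dist x y < e})"
    by (rule uniformity_quat_def)
  show "open U \<longleftrightarrow> (\<forall>x\<in>U. eventually (\<lambda>(x', y). x' = x \<longrightarrow> y \<in> U) uniformity)"
    by (rule open_quat_def)
  show "norm a = 0 \<longleftrightarrow> a = 0"
    by (simp add: norm_quat_def quat_defs quat_eq_iff add_nonneg_eq_0_iff)
  show "norm (r *\<^sub>R a) = \<bar>r\<bar> * norm a"
  proof -
    have "(r * qRe a)\<^sup>2 + (r * qIm1 a)\<^sup>2 + (r * qIm2 a)\<^sup>2 + (r * qIm3 a)\<^sup>2
       = r\<^sup>2 * ((qRe a)\<^sup>2 + (qIm1 a)\<^sup>2 + (qIm2 a)\<^sup>2 + (qIm3 a)\<^sup>2)"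
      by (simp add: power2_eq_square algebra_simps)
    then show ?thesis by (simp add: norm_quat_def scaleR_quat_def real_sqrt_mult)
  qed
  show "norm (a * b) = norm a * norm b"
    unfolding norm_quat_def times_quat_def real_sqrt_mult [symmetric]
    by (rule arg_cong [where f = sqrt]) (simp add: power2_eq_square algebra_simps)
  show "norm (a + b) \<le> norm a + norm b"
  proof -
    let ?c = "\<lambda>q (k::nat). if k = 0 then qRe q else if k = 1 then qIm1 q
        else if k = 2 then qIm2 q else qIm3 q"
    have n: "norm q = L2_set (?c q) {..<4::nat}" for q :: quat
      by (simp add: norm_quat_def L2_set_def numeral_eq_Suc add_ac)
    have "norm (a + b) = L2_set (\<lambda>k. ?c a k + ?c b k) {..<4::nat}"
      unfolding n by (rule L2_set_cong) (auto simp: plus_quat_def)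
    also have "\<dots> \<le> L2_set (?c a) {..<4} + L2_set (?c b) {..<4}"
      by (rule L2_set_triangle_ineq)
    finally show ?thesis unfolding n .
  qed
qed

end

definition qcnj :: "quat \<Rightarrow> quat" where
  "qcnj q = Quat (qRe q) (- qIm1 q) (- qIm2 q) (- qIm3 q)"

definition qIm :: "quat \<Rightarrow> quat" where
  "qIm q = q - of_real (qRe q)"

definition imag_units :: "quat set" where
  "imag_units = {q. q\<^sup>2 = -1}"

text \<open>For \<^term>\<open>j \<in> imag_units\<close> the map \<open>slice_embed j\<close> identifies the complex numbers with
  the plane spanned by 1 and \<open>j\<close>.\<close>

definition slice_embed :: "quat \<Rightarrow> complex \<Rightarrow> quat" where
  "slice_embed j z = of_real (Re z) + of_real (Im z) * j"

definition qsphere :: "quat \<Rightarrow> quat set" where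
  "qsphere q = {of_real (qRe q) + of_real (norm (qIm q)) * j | j. j \<in> imag_units}"

definition axially_symmetric :: "quat set \<Rightarrow> bool" where
  "axially_symmetric U \<longleftrightarrow> (\<forall>q\<in>U. qsphere q \<subseteq> U)"


section \<open>Intrinsic slice hyperholomorphic functions\<close>

definition slice_params :: "quat set \<Rightarrow> (real \<times> real) set" where
  "slice_params U = {(\<alpha>, \<beta>). \<forall>j\<in>imag_units. of_real \<alpha> + of_real \<beta> * j \<in> U}"

text \<open>The derivatives \<open>f0'\<close>, \<open>f1'\<close> are total derivatives; \<open>(1, 0)\<close> and \<open>(0, 1)\<close> are the
  directions of \<open>\<alpha>\<close> and \<open>\<beta>\<close>.\<close>

definition left_slice_components ::
  "quat set \<Rightarrow> (quat \<Rightarrow> quat) \<Rightarrow> (real \<times> real \<Rightarrow> quat) \<Rightarrow> (real \<times> real \<Rightarrow> quat) \<Rightarrow> bool" where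
  "left_slice_components U f f0 f1 \<longleftrightarrow>
     (\<forall>\<alpha> \<beta>. \<forall>j\<in>imag_units. of_real \<alpha> + of_real \<beta> * j \<in> U \<longrightarrow>
        f (of_real \<alpha> + of_real \<beta> * j) = f0 (\<alpha>, \<beta>) + j * f1 (\<alpha>, \<beta>)) \<and>
     (\<forall>\<alpha> \<beta>. (\<alpha>, \<beta>) \<in> slice_params U \<longrightarrow>
        f0 (\<alpha>, - \<beta>) = f0 (\<alpha>, \<beta>) \<and> f1 (\<alpha>, - \<beta>) = - f1 (\<alpha>, \<beta>)) \<and>
     (\<exists>f0' f1' :: real \<times> real \<Rightarrow> (real \<times> real) \<Rightarrow>\<^sub>L quat.
        continuous_on (slice_params U) f0' \<and> continuous_on (slice_params U) f1' \<and>
        (\<forall>p\<in>slice_params U.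
           (f0 has_derivative blinfun_apply (f0' p)) (at p) \<and>
           (f1 has_derivative blinfun_apply (f1' p)) (at p) \<and>
           f0' p (1, 0) - f1' p (0, 1) = 0 \<and>
           f0' p (0, 1) + f1' p (1, 0) = 0))"

definition intrinsic_slice_hyperholomorphic_on :: "quat set \<Rightarrow> (quat \<Rightarrow> quat) \<Rightarrow> bool" where
  "intrinsic_slice_hyperholomorphic_on U f \<longleftrightarrow>
     open U \<and> axially_symmetric U \<and>
     (\<exists>f0 f1. left_slice_components U f f0 f1 \<and>
        (\<forall>p\<in>slice_params U. f0 p \<in> \<real> \<and> f1 p \<in> \<real>))"

text \<open>The restriction of \<open>f\<close> to the plane of \<open>j\<close>, read as a complex function; an intrinsic
  function maps this plane into itself, so the inverse is applied inside the range.\<close>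

definition slice_restrict :: "quat \<Rightarrow> (quat \<Rightarrow> quat) \<Rightarrow> complex \<Rightarrow> complex" where
  "slice_restrict j f z = inv (slice_embed j) (f (slice_embed j z))"


section \<open>Slice Cauchy domains and integrals over their boundaries\<close>

definition jordan_system :: "(real \<Rightarrow> complex) list \<Rightarrow> bool" where
  "jordan_system gs \<longleftrightarrow>
     (\<forall>g\<in>set gs. simple_path g \<and> pathfinish g = pathstart g \<and> valid_path g) \<and>
     disjoint_family_on (\<lambda>k. path_image (gs ! k)) {..<length gs}"

definition is_boundary_system :: "complex set \<Rightarrow> (real \<Rightarrow> complex) list \<Rightarrow> bool" where
  "is_boundary_system A gs \<longleftrightarrow>
     jordan_system gs \<and> frontier A = (\<Union>g\<in>set gs. path_image g)"

text \<open>Positive orientation: the whole system winds once around the points of \<open>A\<close> and not at all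
  around the points outside the closure of \<open>A\<close>, i.e. \<open>A\<close> lies to the left of each curve.\<close>

definition positively_oriented_boundary :: "complex set \<Rightarrow> (real \<Rightarrow> complex) list \<Rightarrow> bool" where
  "positively_oriented_boundary A gs \<longleftrightarrow>
     is_boundary_system A gs \<and>
     (\<forall>z\<in>A. (\<Sum>g\<leftarrow>gs. winding_number g z) = 1) \<and>
     (\<forall>z. z \<notin> closure A \<longrightarrow> (\<Sum>g\<leftarrow>gs. winding_number g z) = 0)"

definition slice_cauchy_domain :: "quat set \<Rightarrow> bool" where
  "slice_cauchy_domain D \<longleftrightarrow>
     open D \<and> axially_symmetric D \<and>
     (\<forall>j\<in>imag_units. \<exists>gs. is_boundary_system (slice_embed j -` D) gs)"

text \<open>Integral of a form \<open>\<omega> s ds\<close>, real linear in \<open>ds\<close>, over a system of curves.  Forms rather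
  than functions are integrated because in noncommutative integrands the position of \<open>ds\<close>
  matters.\<close>

definition boundary_integrable ::
  "(real \<Rightarrow> complex) list \<Rightarrow> (complex \<Rightarrow> complex \<Rightarrow> 'b :: real_normed_vector) \<Rightarrow> bool" where
  "boundary_integrable gs \<omega> \<longleftrightarrow>
     (\<forall>g\<in>set gs. (\<lambda>t. \<omega> (g t) (vector_derivative g (at t within {0..1}))) integrable_on {0..1})"

definition boundary_integral ::
  "(real \<Rightarrow> complex) list \<Rightarrow> (complex \<Rightarrow> complex \<Rightarrow> 'b :: real_normed_vector) \<Rightarrow> 'b" where
  "boundary_integral gs \<omega> =
     (\<Sum>g\<leftarrow>gs. integral {0..1} (\<lambda>t. \<omega> (g t) (vector_derivative g (at t within {0..1}))))"


section \<open>Two-sided quaternionic Banach spaces and their operators\<close>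

text \<open>The real Banach space structure is the one induced by the real quaternions.\<close>

class two_sided_quat_banach = banach +
  fixes lscale :: "quat \<Rightarrow> 'a \<Rightarrow> 'a" (infixr "\<star>\<^sub>l" 75)
    and rscale :: "'a \<Rightarrow> quat \<Rightarrow> 'a" (infixl "\<star>\<^sub>r" 75)
  assumes lscale_add_right: "q \<star>\<^sub>l (x + y) = q \<star>\<^sub>l x + q \<star>\<^sub>l y"
    and lscale_add_left: "(p + q) \<star>\<^sub>l x = p \<star>\<^sub>l x + q \<star>\<^sub>l x"
    and lscale_mult: "(p * q) \<star>\<^sub>l x = p \<star>\<^sub>l (q \<star>\<^sub>l x)"
    and rscale_add_left: "(x + y) \<star>\<^sub>r q = x \<star>\<^sub>r q + y \<star>\<^sub>r q"
    and rscale_add_right: "x \<star>\<^sub>r (p + q) = x \<star>\<^sub>r p + x \<star>\<^sub>r q"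
    and rscale_mult: "x \<star>\<^sub>r (p * q) = (x \<star>\<^sub>r p) \<star>\<^sub>r q"
    and lscale_rscale: "(p \<star>\<^sub>l x) \<star>\<^sub>r q = p \<star>\<^sub>l (x \<star>\<^sub>r q)"
    and lscale_of_real: "of_real r \<star>\<^sub>l x = r *\<^sub>R x"
    and rscale_of_real: "x \<star>\<^sub>r of_real r = r *\<^sub>R x"
    and norm_lscale: "norm (q \<star>\<^sub>l x) = norm q * norm x"
    and norm_rscale: "norm (x \<star>\<^sub>r q) = norm q * norm x"

lift_definition left_mult :: "quat \<Rightarrow> 'a \<Rightarrow>\<^sub>L 'a :: two_sided_quat_banach" is "\<lambda>q x. q \<star>\<^sub>l x"
proof (rule bounded_linear_intro)
  fix q :: quat and x y :: 'a and r :: real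
  show "q \<star>\<^sub>l (x + y) = q \<star>\<^sub>l x + q \<star>\<^sub>l y" by (rule lscale_add_right)
  show "norm (q \<star>\<^sub>l x) \<le> norm x * norm q" by (simp add: norm_lscale)
  have "q \<star>\<^sub>l (r *\<^sub>R x) = q \<star>\<^sub>l (of_real r \<star>\<^sub>l x)" by (simp only: lscale_of_real)
  also have "\<dots> = of_real r \<star>\<^sub>l (q \<star>\<^sub>l x)"
    by (simp only: lscale_mult [symmetric])
      (simp add: of_real_def)
  finally show "q \<star>\<^sub>l (r *\<^sub>R x) = r *\<^sub>R (q \<star>\<^sub>l x)" by (simp only: lscale_of_real)
qed

lift_definition right_mult :: "quat \<Rightarrow> 'a \<Rightarrow>\<^sub>L 'a :: two_sided_quat_banach" is "\<lambda>q x. x \<star>\<^sub>r q"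
proof (rule bounded_linear_intro)
  fix q :: quat and x y :: 'a and r :: real
  show "(x + y) \<star>\<^sub>r q = x \<star>\<^sub>r q + y \<star>\<^sub>r q" by (rule rscale_add_left)
  show "norm (x \<star>\<^sub>r q) \<le> norm x * norm q" by (simp add: norm_rscale)
  show "(r *\<^sub>R x) \<star>\<^sub>r q = r *\<^sub>R (x \<star>\<^sub>r q)"
    by (simp only: lscale_of_real [symmetric] lscale_rscale)
qed

text \<open>The operator spaces on \<open>X\<close> are realised as sets of bounded real linear operators: the right
  linear ones, and those that are complex linear on \<open>X\<close> with the complex structure given by right
  multiplication with the plane of \<open>i\<close>.  Both are norm closed, so integrals in them are integrals
  in the space of bounded real linear operators.\<close>

definition B_R :: "('a :: two_sided_quat_banach \<Rightarrow>\<^sub>L 'a) set" where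
  "B_R = {T :: 'a \<Rightarrow>\<^sub>L 'a. \<forall>x q. T (x \<star>\<^sub>r q) = T x \<star>\<^sub>r q}"

definition B_slice :: "quat \<Rightarrow> ('a :: two_sided_quat_banach \<Rightarrow>\<^sub>L 'a) set" where
  "B_slice i = {T :: 'a \<Rightarrow>\<^sub>L 'a. \<forall>x z. T (x \<star>\<^sub>r slice_embed i z) = T x \<star>\<^sub>r slice_embed i z}"

definition is_inverse_in ::
  "('a :: real_normed_vector \<Rightarrow>\<^sub>L 'a) set \<Rightarrow> ('a \<Rightarrow>\<^sub>L 'a) \<Rightarrow> ('a \<Rightarrow>\<^sub>L 'a) \<Rightarrow> bool" where
  "is_inverse_in B A A' \<longleftrightarrow>
     A' \<in> B \<and> A o\<^sub>L A' = id_blinfun \<and> A' o\<^sub>L A = id_blinfun"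

definition invertible_in :: "('a :: real_normed_vector \<Rightarrow>\<^sub>L 'a) set \<Rightarrow> ('a \<Rightarrow>\<^sub>L 'a) \<Rightarrow> bool" where
  "invertible_in B A \<longleftrightarrow> A \<in> B \<and> (\<exists>A'. is_inverse_in B A A')"

definition inverse_in ::
  "('a :: real_normed_vector \<Rightarrow>\<^sub>L 'a) set \<Rightarrow> ('a \<Rightarrow>\<^sub>L 'a) \<Rightarrow> ('a \<Rightarrow>\<^sub>L 'a)" where
  "inverse_in B A = (THE A'. is_inverse_in B A A')"

text \<open>Right multiplication of an operator by a quaternion: \<open>(T q) x = T (q x)\<close>.\<close>

definition op_rscale ::
  "('a :: two_sided_quat_banach \<Rightarrow>\<^sub>L 'a) \<Rightarrow> quat \<Rightarrow> ('a \<Rightarrow>\<^sub>L 'a)" (infixl "\<diamondop>\<^sub>r" 75) where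
  "T \<diamondop>\<^sub>r q = T o\<^sub>L left_mult q"

text \<open>Complex scalar multiplication of operators on \<open>X\<close> with the complex structure of the plane of
  \<open>i\<close>: \<open>(c T) x = (T x) c\<close>.\<close>

definition slice_op_scale ::
  "quat \<Rightarrow> complex \<Rightarrow> ('a :: two_sided_quat_banach \<Rightarrow>\<^sub>L 'a) \<Rightarrow> ('a \<Rightarrow>\<^sub>L 'a)" where
  "slice_op_scale i c T = right_mult (slice_embed i c) o\<^sub>L T"


section \<open>S-spectrum and the two functional calculi\<close>

definition Q_op :: "quat \<Rightarrow> ('a :: two_sided_quat_banach \<Rightarrow>\<^sub>L 'a) \<Rightarrow> ('a \<Rightarrow>\<^sub>L 'a)" where
  "Q_op q T = (T o\<^sub>L T) - (2 * qRe q) *\<^sub>R T + (norm q)\<^sup>2 *\<^sub>R id_blinfun"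

definition S_resolvent_set :: "('a :: two_sided_quat_banach \<Rightarrow>\<^sub>L 'a) \<Rightarrow> quat set" where
  "S_resolvent_set T = {q. invertible_in B_R (Q_op q T)}"

definition S_spectrum :: "('a :: two_sided_quat_banach \<Rightarrow>\<^sub>L 'a) \<Rightarrow> quat set" where
  "S_spectrum T = UNIV - S_resolvent_set T"

definition left_S_resolvent :: "quat \<Rightarrow> ('a :: two_sided_quat_banach \<Rightarrow>\<^sub>L 'a) \<Rightarrow> ('a \<Rightarrow>\<^sub>L 'a)" where
  "left_S_resolvent s T = - (inverse_in B_R (Q_op s T) o\<^sub>L (T - left_mult (qcnj s)))"

definition S_integrand ::
  "quat \<Rightarrow> (quat \<Rightarrow> quat) \<Rightarrow> ('a :: two_sided_quat_banach \<Rightarrow>\<^sub>L 'a) \<Rightarrow> complex \<Rightarrow> complex \<Rightarrow> ('a \<Rightarrow>\<^sub>L 'a)"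
  where "S_integrand i f T s ds =
     left_S_resolvent (slice_embed i s) T \<diamondop>\<^sub>r (- i * slice_embed i ds) \<diamondop>\<^sub>r f (slice_embed i s)"

definition S_calculus ::
  "quat \<Rightarrow> (real \<Rightarrow> complex) list \<Rightarrow> (quat \<Rightarrow> quat) \<Rightarrow> ('a :: two_sided_quat_banach \<Rightarrow>\<^sub>L 'a) \<Rightarrow> ('a \<Rightarrow>\<^sub>L 'a)"
  where "S_calculus i gs f T = (1 / (2 * pi)) *\<^sub>R boundary_integral gs (S_integrand i f T)"

definition Delta :: "quat \<Rightarrow> ('a :: two_sided_quat_banach \<Rightarrow>\<^sub>L 'a) \<Rightarrow> ('a \<Rightarrow>\<^sub>L 'a)" where
  "Delta s T = right_mult s - T"

definition Riesz_Dunford_integrand ::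
  "quat \<Rightarrow> (complex \<Rightarrow> complex) \<Rightarrow> ('a :: two_sided_quat_banach \<Rightarrow>\<^sub>L 'a) \<Rightarrow> complex \<Rightarrow> complex \<Rightarrow> ('a \<Rightarrow>\<^sub>L 'a)"
  where "Riesz_Dunford_integrand i g T s ds =
     slice_op_scale i (g s * ds) (inverse_in (B_slice i) (Delta (slice_embed i s) T))"

definition Riesz_Dunford_calculus ::
  "quat \<Rightarrow> (real \<Rightarrow> complex) list \<Rightarrow> (complex \<Rightarrow> complex) \<Rightarrow> ('a :: two_sided_quat_banach \<Rightarrow>\<^sub>L 'a) \<Rightarrow> ('a \<Rightarrow>\<^sub>L 'a)"
  where "Riesz_Dunford_calculus i gs g T =
     slice_op_scale i (1 / (2 * pi * \<i>)) (boundary_integral gs (Riesz_Dunford_integrand i g T))"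

end

theory Submission
  imports Defs
begin

text \<open>
  Put \<open>\<omega>(s, ds) = \<Delta>\<^sub>s\<^sup>-\<^sup>1 f(s) ds\<close>, with scalars acting by right multiplication on vectors, and let \<open>C\<close> be
  conjugation of operators by right multiplication with a unit \<open>j\<close> anticommuting with \<open>i\<close>. Since
  \<open>\<Delta>\<^sub>s\<^sup>-\<^sup>1 = Q\<^sub>s\<^sup>-\<^sup>1 (R - T)\<close> with \<open>R\<close> the right multiplication by the conjugate of \<open>s\<close>, and since \<open>f\<close> is intrinsic,
  \<open>C\<close> maps \<open>\<omega>(s, ds)\<close> to \<open>\<omega>\<close> at the conjugates of \<open>s\<close> and \<open>ds\<close>. Complex conjugation maps the
  boundary cycle to one homologous to its negative, so the integral \<open>I\<close> of \<open>\<omega>\<close> satisfies \<open>C I = - I\<close>.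
  The integrand of the S-functional calculus and \<open>- i \<omega>\<close> have the form \<open>b - a i\<close> with the same \<open>C\<close>-invariant
  \<open>a\<close> and \<open>b\<close>, where \<open>i\<close> acts by left multiplication in the former and by right multiplication in the
  latter. As \<open>C I = - I\<close> says that \<open>a\<close> integrates to 0, the two integrals agree.

  The invariance of the integral under homology is Cauchy's theorem for cycles, proved after Dixon
  and transferred to operator-valued integrands by the Hahn-Banach theorem. Curves need not be
  rectifiable here, so integrability comes from local primitives.
\<close>

section \<open>Cauchy's theorem for cycles\<close>

lemma negligible_image_polynomial_path:
  fixes p :: "real \<Rightarrow> complex"
  assumes "polynomial_function p"
  shows "negligible (path_image p)"
proof -
  have "p differentiable_on {0..1}"
    using assms by (simp add: differentiable_at_imp_differentiable_on differentiable_at_polynomial_function)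
  then show ?thesis
    unfolding path_image_def by (intro negligible_differentiable_image_lowdim) auto
qed

text \<open>Loops uniformly close to \<open>g\<close> have the same integrals of holomorphic
  functions, so a polynomial approximation serves, and a small translation takes it off
  \<open>z\<close> because its image is a null set. Polynomial loops have bounded derivative, which
  allows limits under the integral.\<close>

lemma polynomial_loop_avoiding_point:
  assumes "open S" "valid_path g" "path_image g \<subseteq> S" "pathfinish g = pathstart g"
  obtains p where "polynomial_function p" "pathfinish p = pathstart p" "path_image p \<subseteq> S"
    "z \<notin> path_image p"
    "\<And>f. f holomorphic_on S \<Longrightarrow> contour_integral p f = contour_integral g f"
proof -
  have "path g" using assms(2) by (rule valid_path_imp_path)
  obtain e where "e > 0" and e: "\<And>h k. \<lbrakk>valid_path h; valid_path k; 
       \<forall>t\<in>{0..1}. norm (h t - g t) < e \<and> norm (k t - g t) < e;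
       pathfinish h = pathstart h; pathfinish k = pathstart k\<rbrakk> \<Longrightarrow>
       path_image h \<subseteq> S \<and> path_image k \<subseteq> S \<and> (\<forall>f. f holomorphic_on S \<longrightarrow> contour_integral k f = contour_integral h f)"
    using contour_integral_nearby_loops [OF assms(1) \<open>path g\<close> assms(3)] by metis
  obtain q where q: "polynomial_function q" "pathstart q = pathstart g" "pathfinish q = pathfinish g"
     and qg: "\<And>t. t \<in> {0..1} \<Longrightarrow> norm (q t - g t) < e/2"
    using path_approx_polynomial_function [OF \<open>path g\<close>, of "e/2"] \<open>e > 0\<close> by (metis half_gt_zero)
  have "negligible (path_image q)" using q(1) by (rule negligible_image_polynomial_path)
  then have "\<not> ball z (e/2) \<subseteq> path_image q"
    using \<open>e > 0\<close> by (metis negligible_subset open_ball open_not_negligible centre_in_ball empty_iff half_gt_zero)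
  then obtain c where c: "c \<in> ball z (e/2)" "c \<notin> path_image q" by blast
  \<comment> \<open>The shifted loop misses \<open>z\<close> because \<open>q\<close> misses
    \<open>c\<close>, and it stays within \<open>e\<close> of \<open>g\<close> because
    \<open>c\<close> is within \<open>e/2\<close> of \<open>z\<close>.\<close>
  define p where "p = (\<lambda>t. q t + (z - c))"
  have poly: "polynomial_function p"
    unfolding p_def using q(1) by (intro polynomial_function_add polynomial_function_const)
  have loop: "pathfinish p = pathstart p"
    using q assms(4) by (simp add: p_def pathfinish_def pathstart_def)
  have near: "norm (p t - g t) < e" if "t \<in> {0..1}" for t
  proof -
    have "norm (p t - g t) \<le> norm (q t - g t) + norm (z - c)"
      unfolding p_def by (metis add.commute add_diff_eq norm_triangle_ineq)
    then show ?thesis using qg [OF that] c(1) by (simp add: dist_norm)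
  qed
  have *: "path_image p \<subseteq> S" "\<And>f. f holomorphic_on S \<Longrightarrow> contour_integral p f = contour_integral g f"
    using e [of g p] assms poly loop near \<open>e > 0\<close> by (auto simp: valid_path_polynomial_function)
  have "z \<notin> path_image p"
  proof
    assume "z \<in> path_image p"
    then obtain t where "t \<in> {0..1}" "z = q t + (z - c)" by (auto simp: path_image_def p_def)
    then have "c = q t" by simp
    then show False using c(2) \<open>t \<in> {0..1}\<close> by (auto simp: path_image_def)
  qed
  with * poly loop show ?thesis using that by blast
qed

lemma polynomial_path_derivative_bounded:
  fixes p :: "real \<Rightarrow> complex"
  assumes "polynomial_function p"
  obtains B where "\<And>t. t \<in> {0..1} \<Longrightarrow> norm (vector_derivative p (at t)) \<le> B"
proof -
  obtain p' where p': "polynomial_function p'" "\<And>x. (p has_vector_derivative p' x) (at x)"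
    using has_vector_derivative_polynomial_function [OF assms] by blast
  have "bounded (p' ` {0..1})"
    by (intro compact_imp_bounded compact_continuous_image continuous_on_polymonial_function p') auto
  then obtain B where "\<And>t. t \<in> {0..1} \<Longrightarrow> norm (p' t) \<le> B" unfolding bounded_iff by blast
  with that p'(2) show ?thesis by (metis vector_derivative_at)
qed

section \<open>Cauchy transforms along polynomial paths\<close>

lemma contour_integrable_Cauchy_kernel:
  assumes "polynomial_function p" "continuous_on (path_image p) f" "z \<notin> path_image p"
  shows "(\<lambda>w. f w / (w - z)) contour_integrable_on p"
proof -
  obtain p' where p': "polynomial_function p'" "\<And>x. (p has_vector_derivative p' x) (at x)"
    using has_vector_derivative_polynomial_function [OF assms(1)] by blast
  have cp: "continuous_on {0..1} p"
    using assms(1) by (simp add: continuous_on_polymonial_function)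
  have "continuous_on {0..1} (\<lambda>t. f (p t) / (p t - z) * p' t)"
    using assms(3) p'(1)
    by (intro continuous_intros continuous_on_polymonial_function cp continuous_on_compose2 [OF assms(2) cp])
       (auto simp: path_image_def)
  then have "(\<lambda>t. f (p t) / (p t - z) * p' t) integrable_on {0..1}"
    by (rule integrable_continuous_real)
  then show ?thesis
    by (simp add: contour_integrable_on vector_derivative_at [OF p'(2)])
qed

text \<open>Differentiation under the integral sign. Only values of \<open>f\<close> on the path
  enter, so \<open>z\<close> may lie outside the domain of \<open>f\<close>.\<close>

lemma holomorphic_on_Cauchy_transform:
  assumes "polynomial_function p" "continuous_on (path_image p) f"
  shows "(\<lambda>z. contour_integral p (\<lambda>w. f w / (w - z))) holomorphic_on - path_image p"
proof -
  obtain B where B: "\<And>t. t \<in> {0..1} \<Longrightarrow> norm (vector_derivative p (at t)) \<le> B"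
    using polynomial_path_derivative_bounded [OF assms(1)] by blast
  have vp: "valid_path p" using assms(1) by (rule valid_path_polynomial_function)
  have "((\<lambda>z. contour_integral p (\<lambda>w. f w / (w - z))) has_field_derivative
      (of_nat 1 * contour_integral p (\<lambda>u. f u / (u-z)^(Suc 1)))) (at z)" if "z \<notin> path_image p" for z
  proof (rule Cauchy_next_derivative(2) [OF assms(2) B _ _ open_UNIV vp])
    show "((\<lambda>u. f u / (u - w) ^ 1) has_contour_integral contour_integral p (\<lambda>x. f x / (x - w))) p"
      if "w \<in> UNIV - path_image p" for w
      using contour_integrable_Cauchy_kernel [OF assms, of w] that
      by (simp add: has_contour_integral_integral)
  qed (use that in auto)
  then show ?thesis
    by (meson ComplI ComplD holomorphic_on_def field_differentiable_at_within field_differentiable_def)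
qed

text \<open>The path image is compact, so the kernel tends to 0 uniformly along it.\<close>

lemma Cauchy_transform_tendsto_0:
  assumes "polynomial_function p" "continuous_on (path_image p) f"
  shows "((\<lambda>z. contour_integral p (\<lambda>w. f w / (w - z))) \<longlongrightarrow> 0) at_infinity"
proof -
  obtain B where B: "\<And>t. t \<in> {0..1} \<Longrightarrow> norm (vector_derivative p (at t)) \<le> B"
    using polynomial_path_derivative_bounded [OF assms(1)] by blast
  have vp: "valid_path p" using assms(1) by (rule valid_path_polynomial_function)
  have cpt: "compact (path_image p)" using vp by (rule compact_valid_path_image)
  obtain C where C: "C > 0" "\<And>w. w \<in> path_image p \<Longrightarrow> norm w \<le> C"
    using compact_imp_bounded [OF cpt] bounded_pos by metis
  obtain M where M: "M > 0" "\<And>w. w \<in> path_image p \<Longrightarrow> norm (f w) \<le> M"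
    using compact_imp_bounded [OF compact_continuous_image [OF assms(2) cpt]] bounded_pos
    by (metis imageI)
  have ev: "\<forall>\<^sub>F z in at_infinity. (\<lambda>w. f w / (w - z)) contour_integrable_on p"
    unfolding eventually_at_infinity
  proof (intro exI allI impI)
    fix z :: complex assume "C + 1 \<le> norm z"
    then show "(\<lambda>w. f w / (w - z)) contour_integrable_on p"
      using C contour_integrable_Cauchy_kernel [OF assms, of z] by force
  qed
  have ul: "uniform_limit (path_image p) (\<lambda>(z::complex) w. f w / (w - z)) (\<lambda>w. 0) at_infinity"
    unfolding uniform_limit_iff eventually_at_infinity
  proof (intro allI impI)
    fix e :: real assume "e > 0"
    show "\<exists>b. \<forall>z. b \<le> norm z \<longrightarrow> (\<forall>w\<in>path_image p. dist (f w / (w - z)) 0 < e)"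
    proof (intro exI allI impI ballI)
      \<comment> \<open>This threshold forces \<open>norm (w - z)\<close> above
        \<open>M / e\<close>.\<close>
      fix z w :: complex assume z: "C + M / e + 1 \<le> norm z" and w: "w \<in> path_image p"
      have "norm z - norm w \<le> norm (w - z)" by (metis norm_minus_commute norm_triangle_ineq2)
      then have *: "M / e < norm (w - z)" using z C(2) [OF w] by linarith
      have "norm (f w) \<le> M" using M(2) w by blast
      also have "M < e * norm (w - z)" using * \<open>e > 0\<close> by (simp add: field_simps)
      finally have "norm (f w) < e * norm (w - z)" .
      moreover have "norm (w - z) > 0" using * M(1) \<open>e > 0\<close>
        by (meson divide_pos_pos less_trans)
      ultimately show "dist (f w / (w - z)) 0 < e"
        by (simp add: norm_divide field_simps)
    qed
  qed
  have "((\<lambda>z. contour_integral p (\<lambda>w. f w / (w - z))) \<longlongrightarrow> contour_integral p (\<lambda>w. 0)) at_infinity"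
    using contour_integral_uniform_limit [OF ev ul B vp] by (simp add: trivial_limit_at_infinity)
  then show ?thesis by simp
qed

section \<open>Dixon's argument with difference quotients\<close>

definition divided_difference :: "(complex \<Rightarrow> complex) \<Rightarrow> complex \<Rightarrow> complex \<Rightarrow> complex" where
  "divided_difference f z w = (if w = z then deriv f z else (f w - f z) / (w - z))"

text \<open>The diagonal value \<open>deriv f z\<close> removes the singularity at
  \<open>z\<close>.\<close>

lemma holomorphic_on_divided_difference:
  assumes "f holomorphic_on S" "open S"
  shows "divided_difference f z holomorphic_on S"
  using pole_lemma_open [OF assms, of z] by (simp add: divided_difference_def [abs_def])

text \<open>Off the path the integral splits into a Cauchy transform and \<open>f z\<close> times a
  multiple of the winding number. Where the winding numbers of a cycle sum to 0, only Cauchy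
  transforms remain.\<close>

lemma contour_integral_divided_difference:
  assumes "polynomial_function p" "continuous_on (path_image p) f" "z \<notin> path_image p"
  shows "contour_integral p (divided_difference f z) =
    contour_integral p (\<lambda>w. f w / (w - z)) - f z * contour_integral p (\<lambda>w. 1 / (w - z))"
proof -
  have "contour_integral p (divided_difference f z)
      = contour_integral p (\<lambda>w. f w / (w - z) - f z * (1 / (w - z)))"
    using assms(3) by (intro contour_integral_eq) (auto simp: divided_difference_def diff_divide_distrib)
  also have "\<dots> = contour_integral p (\<lambda>w. f w / (w - z)) - contour_integral p (\<lambda>w. f z * (1 / (w - z)))"
    using contour_integrable_Cauchy_kernel [OF assms]
      contour_integrable_Cauchy_kernel [OF assms(1) _ assms(3), of "\<lambda>_. 1"]
    by (intro contour_integral_diff contour_integrable_lmul) auto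
  finally show ?thesis
    using contour_integrable_Cauchy_kernel [OF assms(1) _ assms(3), of "\<lambda>_. 1"]
    by (simp only: contour_integral_lmul [of "\<lambda>w. 1 / (w - z)" p "f z"] continuous_on_const)
qed

text \<open>The loop may pass through the point where differentiability is asked for; it is first moved off that point.\<close>

lemma holomorphic_on_contour_integral_divided_difference:
  assumes "open S" "f holomorphic_on S"
    and g: "valid_path g" "path_image g \<subseteq> S" "pathfinish g = pathstart g"
  shows "(\<lambda>z. contour_integral g (divided_difference f z)) holomorphic_on S"
proof -
  have "(\<lambda>z. contour_integral g (divided_difference f z)) field_differentiable at z0"
    if "z0 \<in> S" for z0
  proof -
    obtain p where p: "polynomial_function p" "path_image p \<subseteq> S" "z0 \<notin> path_image p"
      and pg: "\<And>f. f holomorphic_on S \<Longrightarrow> contour_integral p f = contour_integral g f"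
      using polynomial_loop_avoiding_point [OF assms(1) g, of z0] by metis
    have contf: "continuous_on (path_image p) f"
      using assms(2) p(2) holomorphic_on_imp_continuous_on holomorphic_on_subset by blast
    let ?V = "S - path_image p"
    have "open ?V"
      using assms(1) closed_path_image p(1) path_polynomial_function by (intro open_Diff) auto
    have "(\<lambda>z. contour_integral p (\<lambda>w. f w / (w - z)) - f z * contour_integral p (\<lambda>w. 1 / (w - z)))
        holomorphic_on ?V"
      by (intro holomorphic_intros holomorphic_on_subset [OF assms(2)]
            holomorphic_on_subset [OF holomorphic_on_Cauchy_transform [OF p(1)]] contf) auto
    moreover have "contour_integral p (\<lambda>w. f w / (w - z)) - f z * contour_integral p (\<lambda>w. 1 / (w - z))
        = contour_integral g (divided_difference f z)" if "z \<in> ?V" for z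
      using contour_integral_divided_difference [OF p(1) contf] that
        pg [OF holomorphic_on_divided_difference [OF assms(2,1)]] by auto
    ultimately have "(\<lambda>z. contour_integral g (divided_difference f z)) holomorphic_on ?V"
      by (rule holomorphic_transform)
    then show ?thesis
      using \<open>open ?V\<close> that p(3) by (auto intro: holomorphic_on_imp_differentiable_at)
  qed
  then show ?thesis
    using assms(1) by (simp add: holomorphic_on_def field_differentiable_at_within)
qed

lemma holomorphic_on_sum_list:
  "(\<And>g. g \<in> set gs \<Longrightarrow> F g holomorphic_on S) \<Longrightarrow> (\<lambda>z. \<Sum>g\<leftarrow>gs. F g z) holomorphic_on S"
  by (induction gs) (auto intro!: holomorphic_intros)

lemma continuous_on_sum_list:
  fixes F :: "'a \<Rightarrow> 'b :: topological_space \<Rightarrow> 'c :: real_normed_vector"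
  shows "(\<And>g. g \<in> set gs \<Longrightarrow> continuous_on S (F g)) \<Longrightarrow> continuous_on S (\<lambda>z. \<Sum>g\<leftarrow>gs. F g z)"
  by (induction gs) (auto intro!: continuous_intros)

lemma tendsto_0_sum_list:
  fixes F :: "'a \<Rightarrow> 'b \<Rightarrow> 'c :: real_normed_vector"
  shows "(\<And>g. g \<in> set gs \<Longrightarrow> (F g \<longlongrightarrow> 0) A) \<Longrightarrow> ((\<lambda>z. \<Sum>g\<leftarrow>gs. F g z) \<longlongrightarrow> 0) A"
  by (induction gs) (auto intro!: tendsto_eq_intros)

text \<open>As a function of \<open>z\<close> the sum extends to an entire function that tends to 0
  at infinity, so Liouville's theorem makes it 0.\<close>

lemma contour_integral_divided_difference_cycle:
  assumes "open S" "f holomorphic_on S"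
    and gs: "\<And>g. g \<in> set gs \<Longrightarrow> polynomial_function g \<and> pathfinish g = pathstart g \<and> path_image g \<subseteq> S"
    and zero: "\<And>z. z \<notin> S \<Longrightarrow> (\<Sum>g\<leftarrow>gs. winding_number g z) = 0"
    and "z \<in> S"
  shows "(\<Sum>g\<leftarrow>gs. contour_integral g (divided_difference f z)) = 0"
proof -
  \<comment> \<open>Outside \<open>S\<close> the Cauchy transforms take over; \<open>h_V\<close>
    shows that they also give \<open>h\<close> on the part of \<open>S\<close> off the curves where
    the total winding number is 0.\<close>
  define h where "h z = (if z \<in> S then \<Sum>g\<leftarrow>gs. contour_integral g (divided_difference f z)
      else \<Sum>g\<leftarrow>gs. contour_integral g (\<lambda>w. f w / (w - z)))" for z
  define n where "n z = (\<Sum>g\<leftarrow>gs. contour_integral g (\<lambda>w. 1 / (w - z)))" for z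
  define P where "P = (\<Union>g\<in>set gs. path_image g)"
  have vp: "valid_path g" if "g \<in> set gs" for g
    using gs [OF that] valid_path_polynomial_function by blast
  have contf: "continuous_on (path_image g) f" if "g \<in> set gs" for g
    using assms(2) gs [OF that] holomorphic_on_imp_continuous_on holomorphic_on_subset by blast
  have PS: "P \<subseteq> S" using gs by (auto simp: P_def)
  have cptP: "compact P"
    unfolding P_def by (intro compact_UN) (auto simp: vp compact_valid_path_image)
  have n_eq: "n z = 2 * pi * \<i> * (\<Sum>g\<leftarrow>gs. winding_number g z)" if "z \<notin> P" for z
  proof -
    have "n z = (\<Sum>g\<leftarrow>gs. 2 * pi * \<i> * winding_number g z)"
      unfolding n_def
    proof (intro arg_cong [where f = sum_list] map_cong refl)
      fix g assume g: "g \<in> set gs"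
      then have "z \<notin> path_image g" using that by (auto simp: P_def)
      then show "contour_integral g (\<lambda>w. 1 / (w - z)) = 2 * pi * \<i> * winding_number g z"
        using vp [OF g] by (simp add: winding_number_valid_path)
    qed
    then show ?thesis by (simp add: sum_list_const_mult)
  qed
  \<comment> \<open>By the hypothesis \<open>zero\<close>, \<open>S\<close> and \<open>V\<close>
    cover the plane; \<open>h\<close> will be holomorphic on each.\<close>
  define V where "V = {z \<in> - P. (\<Sum>g\<leftarrow>gs. winding_number g z) = 0}"
  have Ints: "(\<Sum>g\<leftarrow>gs. winding_number g z) \<in> \<int>" if "z \<notin> P" for z
  proof -
    have "set hs \<subseteq> set gs \<Longrightarrow> (\<Sum>g\<leftarrow>hs. winding_number g z) \<in> \<int>" for hs
    proof (induction hs)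
      case (Cons g hs)
      have "winding_number g z \<in> \<int>"
        using Cons.prems gs [of g] vp [of g] that
        by (intro integer_winding_number) (auto simp: P_def valid_path_imp_path)
      with Cons show ?case by auto
    qed auto
    then show ?thesis by simp
  qed
  have "continuous_on (- P) (\<lambda>z. \<Sum>g\<leftarrow>gs. winding_number g z)"
    by (intro continuous_on_sum_list continuous_on_subset [OF continuous_on_winding_number])
       (use gs vp in \<open>auto simp: P_def valid_path_imp_path\<close>)
  \<comment> \<open>Off \<open>P\<close> the total winding number is an integer, so modulus below 1
    means 0, and \<open>V\<close> is the preimage of an open disc.\<close>
  then have "open (- P \<inter> (\<lambda>z. \<Sum>g\<leftarrow>gs. winding_number g z) -` ball 0 1)"
    using cptP by (intro continuous_open_preimage) (auto simp: compact_imp_closed)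
  also have "- P \<inter> (\<lambda>z. \<Sum>g\<leftarrow>gs. winding_number g z) -` ball 0 1 = V"
  proof -
    have "w = 0" if "w \<in> \<int>" "norm w < 1" for w :: complex
      using that by (auto elim!: Ints_cases)
    then show ?thesis using Ints by (auto simp: V_def)
  qed
  finally have "open V" .
  have h_V: "h z = (\<Sum>g\<leftarrow>gs. contour_integral g (\<lambda>w. f w / (w - z)))" if "z \<in> V" for z
  proof (cases "z \<in> S")
    case True
    have "h z = (\<Sum>g\<leftarrow>gs. contour_integral g (\<lambda>w. f w / (w - z)) - f z * contour_integral g (\<lambda>w. 1 / (w - z)))"
      using that True gs contf unfolding h_def V_def P_def
      by (auto intro!: arg_cong [where f = sum_list] contour_integral_divided_difference)
    also have "\<dots> = (\<Sum>g\<leftarrow>gs. contour_integral g (\<lambda>w. f w / (w - z))) - f z * n z"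
      by (simp add: n_def sum_list_subtractf sum_list_const_mult)
    also have "n z = 0" using that n_eq by (simp add: V_def)
    finally show ?thesis by simp
  qed (simp add: h_def)
  have tr: "(\<lambda>z. \<Sum>g\<leftarrow>gs. contour_integral g (\<lambda>w. f w / (w - z))) holomorphic_on - P"
    by (intro holomorphic_on_sum_list holomorphic_on_subset [OF holomorphic_on_Cauchy_transform])
       (use gs contf in \<open>auto simp: P_def\<close>)
  have "h holomorphic_on S"
  proof (rule holomorphic_transform)
    show "(\<lambda>z. \<Sum>g\<leftarrow>gs. contour_integral g (divided_difference f z)) holomorphic_on S"
      by (intro holomorphic_on_sum_list holomorphic_on_contour_integral_divided_difference)
         (use assms vp in auto)
  qed (simp add: h_def)
  moreover have "h holomorphic_on V"
  proof (rule holomorphic_transform)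
    show "(\<lambda>z. \<Sum>g\<leftarrow>gs. contour_integral g (\<lambda>w. f w / (w - z))) holomorphic_on V"
      using tr by (rule holomorphic_on_subset) (auto simp: V_def)
  qed (simp add: h_V)
  moreover have "S \<union> V = UNIV" using zero PS by (auto simp: V_def)
  ultimately have "h holomorphic_on UNIV"
    using holomorphic_on_Un [of h S V] \<open>open S\<close> \<open>open V\<close> by simp
  moreover have "(h \<longlongrightarrow> 0) at_infinity"
  proof (rule Lim_transform_eventually)
    show "((\<lambda>z. \<Sum>g\<leftarrow>gs. contour_integral g (\<lambda>w. f w / (w - z))) \<longlongrightarrow> 0) at_infinity"
      by (intro tendsto_0_sum_list Cauchy_transform_tendsto_0) (use gs contf in auto)
    obtain C where C: "\<And>w. w \<in> P \<Longrightarrow> norm w \<le> C"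
      using compact_imp_bounded [OF cptP] by (auto simp: bounded_iff)
    \<comment> \<open>Winding numbers vanish outside a disc containing \<open>P\<close>, so a
      neighbourhood of infinity lies in \<open>V\<close>.\<close>
    have "z \<in> V" if "C + 1 \<le> norm z" for z
    proof -
      have "z \<notin> P" using C that by force
      moreover have "winding_number g z = 0" if "g \<in> set gs" for g
      proof (rule winding_number_zero_outside [of g "cball 0 C"])
        show "path_image g \<subseteq> cball 0 C" using C that unfolding P_def by fastforce
      qed (use \<open>C + 1 \<le> norm z\<close> that gs vp in \<open>auto simp: valid_path_imp_path\<close>)
      then have "map (\<lambda>g. winding_number g z) gs = map (\<lambda>g. 0) gs" by simp
      then have "(\<Sum>g\<leftarrow>gs. winding_number g z) = 0" by (metis sum_list_0)
      ultimately show ?thesis by (simp add: V_def)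
    qed
    then show "\<forall>\<^sub>F z in at_infinity. (\<Sum>g\<leftarrow>gs. contour_integral g (\<lambda>w. f w / (w - z))) = h z"
      unfolding eventually_at_infinity by (metis h_V)
  qed
  ultimately have "h z = 0" by (rule Liouville_weak_0)
  then show ?thesis using \<open>z \<in> S\<close> by (simp add: h_def)
qed

text \<open>For any \<open>z\<close> in \<open>S\<close>, \<open>f\<close> is the divided difference
  at \<open>z\<close> of \<open>F w = f w * (w - z)\<close>, since \<open>F z = 0\<close>. Passing
  to polynomial loops keeps the winding numbers around points outside \<open>S\<close>, as these are
  integrals of functions holomorphic on \<open>S\<close>.\<close>

theorem Cauchy_theorem_cycle:
  assumes "open S" "f holomorphic_on S"
    and gs: "\<And>g. g \<in> set gs \<Longrightarrow> valid_path g \<and> pathfinish g = pathstart g \<and> path_image g \<subseteq> S"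
    and zero: "\<And>z. z \<notin> S \<Longrightarrow> (\<Sum>g\<leftarrow>gs. winding_number g z) = 0"
  shows "(\<Sum>g\<leftarrow>gs. contour_integral g f) = 0"
proof (cases "gs = []")
  case False
  have "\<exists>p. polynomial_function p \<and> pathfinish p = pathstart p \<and> path_image p \<subseteq> S \<and>
      (\<forall>f. f holomorphic_on S \<longrightarrow> contour_integral p f = contour_integral g f)" if "g \<in> set gs" for g
    using polynomial_loop_avoiding_point [OF assms(1), of g] gs [OF that] by metis
  then obtain p where p: "\<And>g. g \<in> set gs \<Longrightarrow> polynomial_function (p g) \<and>
      pathfinish (p g) = pathstart (p g) \<and> path_image (p g) \<subseteq> S"
    and pg: "\<And>g f. g \<in> set gs \<Longrightarrow> f holomorphic_on S \<Longrightarrow> contour_integral (p g) f = contour_integral g f"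
    by metis
  obtain z where z: "z \<in> S"
    using False gs by (metis list.set_sel(1) path_image_nonempty subset_empty equals0I)
  define F where "F w = f w * (w - z)" for w
  have F: "F holomorphic_on S"
    unfolding F_def [abs_def] by (intro holomorphic_intros assms(2))
  have wn: "winding_number (p g) w = winding_number g w" if "g \<in> set gs" "w \<notin> S" for g w
  proof -
    have "(\<lambda>v. 1 / (v - w)) holomorphic_on S"
      using that by (intro holomorphic_intros) auto
    moreover have "w \<notin> path_image g" "w \<notin> path_image (p g)" using that gs p by blast+
    ultimately show ?thesis
      using that gs p pg by (simp add: winding_number_valid_path valid_path_polynomial_function)
  qed
  have "(\<Sum>g\<leftarrow>map p gs. contour_integral g (divided_difference F z)) = 0"
  proof (rule contour_integral_divided_difference_cycle [OF assms(1) F])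
    fix w assume "w \<notin> S"
    then have "(\<Sum>g\<leftarrow>map p gs. winding_number g w) = (\<Sum>g\<leftarrow>gs. winding_number g w)"
      by (simp add: o_def wn cong: map_cong)
    then show "(\<Sum>g\<leftarrow>map p gs. winding_number g w) = 0" using zero \<open>w \<notin> S\<close> by simp
  qed (use p z in auto)
  moreover have "divided_difference F z = f"
  proof
    fix w
    have "deriv F z = f z"
    proof (rule DERIV_imp_deriv)
      have "(f has_field_derivative deriv f z) (at z)"
        using assms(1,2) z by (simp add: holomorphic_derivI)
      then show "(F has_field_derivative f z) (at z)"
        unfolding F_def [abs_def] by (auto intro!: derivative_eq_intros)
    qed
    then show "divided_difference F z w = f w" by (simp add: divided_difference_def F_def)
  qed
  moreover have "map (\<lambda>g. contour_integral (p g) f) gs = map (\<lambda>g. contour_integral g f) gs"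
    using pg [OF _ assms(2)] by simp
  ultimately show ?thesis by (simp add: o_def)
qed simp

section \<open>The Hahn-Banach theorem\<close>

text \<open>A functional of norm at most 1 on a subspace is represented by its graph.\<close>

definition dominated_graph :: "('a :: real_normed_vector \<times> real) set \<Rightarrow> bool" where
  "dominated_graph G \<longleftrightarrow> subspace G \<and> (\<forall>(v, r)\<in>G. r \<le> norm v)"

text \<open>The functional on the span of \<open>x\<close> with value \<open>norm x\<close> at
  \<open>x\<close>: the starting point for Zorn's lemma.\<close>

lemma dominated_graph_span_singleton: "dominated_graph (span {(x, norm x)})"
proof -
  have "r \<le> norm v" if "(v, r) \<in> span {(x, norm x)}" for v r
    using that by (auto simp: span_singleton mult_right_mono)
  then show ?thesis by (auto simp: dominated_graph_def)
qed

lemma dominated_graph_Union_chain: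
  assumes "\<C> \<noteq> {}" "\<And>G. G \<in> \<C> \<Longrightarrow> dominated_graph G"
    and chain: "\<And>G H. G \<in> \<C> \<Longrightarrow> H \<in> \<C> \<Longrightarrow> G \<subseteq> H \<or> H \<subseteq> G"
  shows "dominated_graph (\<Union>\<C>)"
proof -
  have sub: "subspace G" if "G \<in> \<C>" for G
    using assms(2) that by (auto simp: dominated_graph_def)
  have "subspace (\<Union>\<C>)"
    unfolding subspace_def
  proof (intro conjI ballI allI)
    show "0 \<in> \<Union>\<C>" using assms(1) sub subspace_0 by blast
    show "x + y \<in> \<Union>\<C>" if "x \<in> \<Union>\<C>" "y \<in> \<Union>\<C>" for x y
    proof -
      obtain G H where GH: "G \<in> \<C>" "x \<in> G" "H \<in> \<C>" "y \<in> H" using \<open>x \<in> \<Union>\<C>\<close> \<open>y \<in> \<Union>\<C>\<close> by blast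
      with chain [of G H] sub show ?thesis by (meson UnionI subsetD subspace_add)
    qed
    show "c *\<^sub>R x \<in> \<Union>\<C>" if "x \<in> \<Union>\<C>" for c x
      using that sub subspace_scale by blast
  qed
  then show ?thesis using assms(2) by (auto simp: dominated_graph_def)
qed

text \<open>The value \<open>r0\<close> at \<open>v0\<close> has to lie above all
  \<open>r - norm (v - v0)\<close> and below all \<open>norm (v + v0) - r\<close> with
  \<open>(v, r)\<close> in \<open>G\<close>. The triangle inequality leaves room, and the supremum
  of the former is taken.\<close>

lemma dominated_graph_extend:
  assumes "dominated_graph G"
  obtains r0 where "dominated_graph {x + y |x y. x \<in> G \<and> y \<in> span {(v0, r0)}}"
proof -
  have sub: "subspace G" and le: "\<And>v r. (v, r) \<in> G \<Longrightarrow> r \<le> norm v"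
    using assms by (auto simp: dominated_graph_def)
  have key: "r - norm (v - v0) \<le> norm (v' + v0) - r'" if "(v, r) \<in> G" "(v', r') \<in> G" for v r v' r'
  proof -
    have "r + r' \<le> norm (v + v')"
      using subspace_add [OF sub that] le by simp
    also have "\<dots> \<le> norm (v - v0) + norm (v' + v0)"
      using norm_triangle_ineq [of "v - v0" "v' + v0"] by (simp add: algebra_simps)
    finally show ?thesis by simp
  qed
  have 0: "(0, 0) \<in> G" using subspace_0 [OF sub] by (simp add: zero_prod_def)
  define M where "M = (\<lambda>(v, r). r - norm (v - v0)) ` G"
  have "M \<noteq> {}" using 0 by (auto simp: M_def)
  have M: "m \<le> norm (v + v0) - r" if "m \<in> M" "(v, r) \<in> G" for m v r
    using that key by (auto simp: M_def)
  then have "bdd_above M" using 0 by (meson bdd_above.I)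
  have lower: "r - norm (v - v0) \<le> Sup M" if "(v, r) \<in> G" for v r
    using that \<open>bdd_above M\<close> by (intro cSup_upper) (auto simp: M_def image_iff intro: bexI [of _ "(v, r)"])
  have upper: "r + Sup M \<le> norm (v + v0)" if "(v, r) \<in> G" for v r
    using cSup_least [OF \<open>M \<noteq> {}\<close> M [OF _ that]] by simp
  \<comment> \<open>Homogeneity reduces positive \<open>t\<close> to \<open>upper\<close> and
    negative \<open>t\<close> to \<open>lower\<close>.\<close>
  have bound: "r + t * Sup M \<le> norm (v + t *\<^sub>R v0)" if vr: "(v, r) \<in> G" for v r t
  proof (cases t "0 :: real" rule: linorder_cases)
    case equal
    then show ?thesis using le [OF vr] by simp
  next
    case greater
    have "(v /\<^sub>R t, r / t) \<in> G" using subspace_scale [OF sub vr, of "inverse t"] by (simp add: field_simps)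
    have "r + t * Sup M = t * (r / t + Sup M)" using greater by (simp add: field_simps)
    also have "\<dots> \<le> t * norm (v /\<^sub>R t + v0)"
      using mult_left_mono [OF upper [OF \<open>(v /\<^sub>R t, r / t) \<in> G\<close>], of t] greater by simp
    also have "\<dots> = norm (t *\<^sub>R (v /\<^sub>R t + v0))" using greater by simp
    finally show ?thesis using greater by (simp add: scaleR_add_right)
  next
    case less
    have "(v /\<^sub>R (- t), r / (- t)) \<in> G"
      using subspace_scale [OF sub vr, of "inverse (- t)"] by (simp add: field_simps)
    have "r / (- t) \<le> norm (v /\<^sub>R (- t) - v0) + Sup M"
      using lower [OF \<open>(v /\<^sub>R (- t), r / (- t)) \<in> G\<close>] by simp
    from mult_left_mono [OF this, of "- t"] less
    have "r + t * Sup M \<le> (- t) * norm (v /\<^sub>R (- t) - v0)" by (simp add: distrib_left)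
    also have "\<dots> = norm ((- t) *\<^sub>R (v /\<^sub>R (- t) - v0))" using less by simp
    finally show ?thesis using less by (simp add: scaleR_diff_right)
  qed
  have "dominated_graph {x + y |x y. x \<in> G \<and> y \<in> span {(v0, Sup M)}}"
    unfolding dominated_graph_def
  proof
    show "subspace {x + y |x y. x \<in> G \<and> y \<in> span {(v0, Sup M)}}"
      by (rule subspace_sums [OF sub subspace_span])
  qed (use bound in \<open>auto simp: span_singleton\<close>)
  then show ?thesis by (rule that)
qed

theorem Hahn_Banach_norming_functional:
  fixes x :: "'a :: real_normed_vector"
  obtains \<phi> :: "'a \<Rightarrow>\<^sub>L real" where "\<phi> x = norm x"
proof -
  define \<A> where "\<A> = {G. dominated_graph G \<and> (x, norm x) \<in> G}"
  have "\<exists>G\<in>\<A>. \<forall>H\<in>\<A>. G \<subseteq> H \<longrightarrow> H = G"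
  proof (rule subset_Zorn_nonempty)
    show "\<A> \<noteq> {}" using dominated_graph_span_singleton [of x] by (auto simp: \<A>_def intro: span_base)
    show "\<Union>\<C> \<in> \<A>" if "\<C> \<noteq> {}" "subset.chain \<A> \<C>" for \<C>
      using dominated_graph_Union_chain [of \<C>] that by (auto simp: \<A>_def subset_chain_def)
  qed
  then obtain G where G: "dominated_graph G" "(x, norm x) \<in> G"
    and max: "\<And>H. dominated_graph H \<Longrightarrow> (x, norm x) \<in> H \<Longrightarrow> G \<subseteq> H \<Longrightarrow> H = G"
    unfolding \<A>_def by blast
  have sub: "subspace G" and le: "\<And>v r. (v, r) \<in> G \<Longrightarrow> r \<le> norm v"
    using G by (auto simp: dominated_graph_def)
  \<comment> \<open>By maximality, extending \<open>G\<close> to \<open>v\<close> adds nothing, so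
    \<open>v\<close> already has a value.\<close>
  have total: "\<exists>r. (v, r) \<in> G" for v
  proof -
    obtain r0 where r0: "dominated_graph {x + y |x y. x \<in> G \<and> y \<in> span {(v, r0)}}" (is "dominated_graph ?H")
      using dominated_graph_extend [OF G(1)] .
    have "G \<subseteq> ?H" by (metis (mono_tags, lifting) add.right_neutral mem_Collect_eq span_zero subsetI)
    then have "?H = G" using max r0 G(2) by blast
    moreover have "(v, r0) \<in> ?H" using subspace_0 [OF sub] by (metis (mono_tags, lifting) add_0 insertI1 mem_Collect_eq span_base)
    ultimately show ?thesis by auto
  qed
  \<comment> \<open>The difference of the pairs is \<open>(0, r - r')\<close>; domination bounds
    \<open>r - r'\<close> and its negative by \<open>norm 0\<close>.\<close>
  have unique: "r = r'" if "(v, r) \<in> G" "(v, r') \<in> G" for v r r'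
    using le [OF subspace_diff [OF sub that, simplified]] le [OF subspace_diff [OF sub that(2,1), simplified]]
    by simp
  define \<phi> where "\<phi> v = (THE r. (v, r) \<in> G)" for v
  have \<phi>_eq: "\<phi> v = r" if "(v, r) \<in> G" for v r
    unfolding \<phi>_def using that unique by blast
  have \<phi>: "(v, \<phi> v) \<in> G" for v using total \<phi>_eq by metis
  have "bounded_linear \<phi>"
  proof (rule bounded_linear_intro)
    show "\<phi> (v + w) = \<phi> v + \<phi> w" for v w
      by (rule \<phi>_eq) (use subspace_add [OF sub \<phi> \<phi>] in simp)
    show "\<phi> (c *\<^sub>R v) = c *\<^sub>R \<phi> v" for c v
      by (rule \<phi>_eq) (use subspace_scale [OF sub \<phi>] in simp)
    show "norm (\<phi> v) \<le> norm v * 1" for v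
      using le [OF \<phi> [of v]] le [OF subspace_neg [OF sub \<phi> [of v], simplified]] by simp
  qed
  then have "blinfun_apply (Blinfun \<phi>) x = norm x"
    using \<phi>_eq G(2) by (simp add: bounded_linear_Blinfun_apply)
  then show ?thesis by (rule that)
qed

section \<open>Holomorphic functions with values in a complex Banach space\<close>

text \<open>By type the space is only a real Banach space; the bounded operator \<open>J\<close>
  carries multiplication by the imaginary unit.\<close>

locale complex_structure =
  fixes J :: "'b :: banach \<Rightarrow>\<^sub>L 'b"
  assumes J_J: "blinfun_apply J (blinfun_apply J x) = - x"
begin

definition smul :: "complex \<Rightarrow> 'b \<Rightarrow> 'b" where
  "smul c x = Re c *\<^sub>R x + Im c *\<^sub>R blinfun_apply J x"

sublocale smul: bounded_bilinear smul
proof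
  show "smul (a + a') b = smul a b + smul a' b" for a a' b
    by (simp add: smul_def scaleR_add_left)
  show "smul a (b + b') = smul a b + smul a b'" for a b b'
    by (simp add: smul_def blinfun.add_right scaleR_add_right)
  show "smul (r *\<^sub>R a) b = r *\<^sub>R smul a b" for r a b
    by (simp add: smul_def scaleR_add_right)
  show "smul a (r *\<^sub>R b) = r *\<^sub>R smul a b" for r a b
    by (simp add: smul_def scaleR_add_right blinfun.scaleR_right mult.commute)
  show "\<exists>K. \<forall>a b. norm (smul a b) \<le> norm a * norm b * K"
  proof (intro exI allI)
    fix a b
    have "norm (smul a b) \<le> \<bar>Re a\<bar> * norm b + \<bar>Im a\<bar> * norm (blinfun_apply J b)"
      unfolding smul_def by (metis norm_triangle_ineq norm_scaleR)
    also have "\<dots> \<le> norm a * norm b + norm a * (norm J * norm b)"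
      by (intro add_mono mult_mono abs_Re_le_cmod abs_Im_le_cmod norm_blinfun) auto
    finally show "norm (smul a b) \<le> norm a * norm b * (1 + norm J)" by (simp add: algebra_simps)
  qed
qed

lemma smul_smul: "smul a (smul b x) = smul (a * b) x"
  by (simp add: smul_def blinfun.add_right blinfun.scaleR_right J_J algebra_simps)

lemma smul_of_real: "smul (of_real r) x = r *\<^sub>R x"
  by (simp add: smul_def)

text \<open>The complex linear functional with real part \<phi>.\<close>

definition cfun :: "('b \<Rightarrow>\<^sub>L real) \<Rightarrow> 'b \<Rightarrow> complex" where
  "cfun \<phi> x = Complex (blinfun_apply \<phi> x) (- blinfun_apply \<phi> (blinfun_apply J x))"

lemma bounded_linear_cfun: "bounded_linear (cfun \<phi>)"
proof -
  have "cfun \<phi> = (\<lambda>x. of_real (blinfun_apply \<phi> x) - \<i> * of_real (blinfun_apply \<phi> (blinfun_apply J x)))"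
    by (auto simp: cfun_def complex_eq_iff)
  moreover have "bounded_linear \<dots>"
    by (intro bounded_linear_sub bounded_linear_const_mult
        bounded_linear_compose [OF bounded_linear_of_real] bounded_linear_intros)
  ultimately show ?thesis by simp
qed

lemma cfun_smul: "cfun \<phi> (smul c x) = c * cfun \<phi> x"
  by (simp add: cfun_def smul_def complex_eq_iff blinfun.add_right blinfun.scaleR_right J_J
      blinfun.minus_right blinfun.diff_right algebra_simps)

text \<open>A norming functional for \<open>x\<close> suffices. Vector identities can thus be
  checked through scalar contour integrals.\<close>

lemma eq_0_if_cfun_eq_0:
  assumes "\<And>\<phi>. cfun \<phi> x = 0"
  shows "x = 0"
proof -
  obtain \<phi> :: "'b \<Rightarrow>\<^sub>L real" where "\<phi> x = norm x" by (rule Hahn_Banach_norming_functional)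
  then show ?thesis using assms [of \<phi>] by (simp add: cfun_def complex_eq_iff)
qed

text \<open>Radial integration; differentiating under the integral sign turns the integrand into the
  derivative of \<open>t *\<^sub>R G (z0 + t *\<^sub>R (s - z0))\<close>.\<close>

lemma local_primitive:
  assumes U: "convex U" "open U" "z0 \<in> U"
    and G: "\<And>s. s \<in> U \<Longrightarrow> (G has_derivative (\<lambda>h. smul h (K s))) (at s)"
    and K: "continuous_on U K"
  obtains P where "\<And>s. s \<in> U \<Longrightarrow> (P has_derivative (\<lambda>h. smul h (G s))) (at s)"
proof -
  define p where "p s t = z0 + t *\<^sub>R (s - z0)" for s :: complex and t :: real
  define P where "P s = integral (cbox 0 1) (\<lambda>t. smul (s - z0) (G (p s t)))" for s
  have pU: "p s t \<in> U" if "s \<in> U" "t \<in> cbox 0 1" for s t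
    using convexD_alt [OF U(1,3) that(1), of t] that(2) by (simp add: p_def algebra_simps)
  have contG: "continuous_on U G"
    using G by (meson continuous_at_imp_continuous_on has_derivative_continuous)
  have contp: "continuous_on A (\<lambda>x. p (a x) (b x))" if "continuous_on A a" "continuous_on A b" for A a b
    unfolding p_def by (intro continuous_intros that)
  have "(P has_derivative (\<lambda>h. smul h (G s))) (at s)" if s: "s \<in> U" for s
  proof -
    define D where "D s t = smul.prod_left (G (p s t) + smul (t *\<^sub>R (s - z0)) (K (p s t)))" for s t
    have "(P has_derivative integral (cbox 0 1) (D s)) (at s within U)"
      unfolding P_def [abs_def]
    proof (rule leibniz_rule [OF _ _ _ s U(1)])
      fix s t assume st: "s \<in> U" "t \<in> cbox 0 (1 :: real)"
      have "((\<lambda>s. p s t) has_derivative (\<lambda>h. t *\<^sub>R h)) (at s)"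
        by (auto simp: p_def intro!: derivative_eq_intros)
      from has_derivative_compose [OF this G [OF pU [OF st]]]
      have "((\<lambda>s. G (p s t)) has_derivative (\<lambda>h. smul (t *\<^sub>R h) (K (p s t)))) (at s)" .
      then have "((\<lambda>s. smul (s - z0) (G (p s t))) has_derivative
          (\<lambda>h. smul (s - z0) (smul (t *\<^sub>R h) (K (p s t))) + smul h (G (p s t)))) (at s)"
        by (auto intro!: smul.FDERIV derivative_eq_intros)
      moreover have "(\<lambda>h. smul (s - z0) (smul (t *\<^sub>R h) (K (p s t))) + smul h (G (p s t)))
          = blinfun_apply (D s t)"
        by (auto simp: D_def fun_eq_iff smul_smul smul.add_right mult_ac)
      ultimately show "((\<lambda>s. smul (s - z0) (G (p s t))) has_derivative blinfun_apply (D s t)) (at s within U)"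
        by (metis has_derivative_at_withinI)
    next
      fix s assume "s \<in> U"
      have "continuous_on (cbox 0 1) (\<lambda>t. smul (s - z0) (G (p s t)))"
        by (intro smul.continuous_on continuous_on_compose2 [OF contG] contp continuous_intros)
           (use pU \<open>s \<in> U\<close> in auto)
      then show "(\<lambda>t. smul (s - z0) (G (p s t))) integrable_on cbox 0 1"
        by (rule integrable_continuous)
    next
      show "continuous_on (U \<times> cbox 0 1) (\<lambda>(s, t). D s t)"
        unfolding D_def case_prod_unfold
        by (intro bounded_linear.continuous_on [OF smul.bounded_linear_prod_left] continuous_on_add
              smul.continuous_on continuous_on_compose2 [OF contG] continuous_on_compose2 [OF K]
              contp continuous_intros)
           (use pU in auto)
    qed
    moreover have "integral (cbox 0 1) (D s) = smul.prod_left (G s)"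
    proof -
      have "((\<lambda>t. G (p s t) + smul (t *\<^sub>R (s - z0)) (K (p s t))) has_integral (1 *\<^sub>R G (p s 1) - 0 *\<^sub>R G (p s 0))) {0..1}"
      proof (rule fundamental_theorem_of_calculus)
        fix t :: real assume t: "t \<in> {0..1}"
        have "((\<lambda>t. p s t) has_derivative (\<lambda>h. h *\<^sub>R (s - z0))) (at t)"
          by (auto simp: p_def intro!: derivative_eq_intros)
        from has_derivative_compose [OF this G [OF pU [OF s, of t]]] t
        have "((\<lambda>t. G (p s t)) has_derivative (\<lambda>h. smul (h *\<^sub>R (s - z0)) (K (p s t)))) (at t)"
          by simp
        then have "((\<lambda>t. G (p s t)) has_vector_derivative smul (s - z0) (K (p s t))) (at t)"
          by (simp add: has_vector_derivative_def smul.scaleR_left)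
        then have "((\<lambda>t. t *\<^sub>R G (p s t)) has_vector_derivative
            (t *\<^sub>R smul (s - z0) (K (p s t)) + 1 *\<^sub>R G (p s t))) (at t)"
          by (intro has_vector_derivative_scaleR) (auto intro: derivative_eq_intros)
        from has_vector_derivative_at_within [OF this]
        show "((\<lambda>t. t *\<^sub>R G (p s t)) has_vector_derivative
            (G (p s t) + smul (t *\<^sub>R (s - z0)) (K (p s t)))) (at t within {0..1})"
          by (simp add: smul.scaleR_left add.commute)
      qed simp
      then have "((\<lambda>t. G (p s t) + smul (t *\<^sub>R (s - z0)) (K (p s t))) has_integral G s) (cbox 0 1)"
        by (simp add: p_def)
      from has_integral_linear [OF this smul.bounded_linear_prod_left]
      have "(D s has_integral smul.prod_left (G s)) (cbox 0 1)"
        by (simp add: D_def [abs_def] o_def)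
      then show ?thesis by (rule integral_unique)
    qed
    ultimately have "(P has_derivative blinfun_apply (smul.prod_left (G s))) (at s)"
      using at_within_open [OF s U(2)] by simp
    then show ?thesis by simp
  qed
  then show ?thesis by (rule that)
qed

text \<open>The derivative of \<open>g\<close> may be unbounded near the finite set where
  \<open>g\<close> is not differentiable. For a local primitive \<open>P\<close>, the composition of
  \<open>P\<close> with \<open>g\<close> is continuous and, off that set, differentiable; the
  fundamental theorem gives integrability on small subintervals, which suffices.\<close>

lemma integrable_along_path:
  assumes "open S" "valid_path g" "path_image g \<subseteq> S"
    and G: "\<And>s. s \<in> S \<Longrightarrow> (G has_derivative (\<lambda>h. smul h (K s))) (at s)"
    and K: "continuous_on S K"
  shows "(\<lambda>t. smul (vector_derivative g (at t within {0..1})) (G (g t))) integrable_on {0..1}"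
proof -
  obtain F where F: "finite F" "g C1_differentiable_on {0..1} - F" and contg: "continuous_on {0..1} g"
    using assms(2) by (auto simp: valid_path_def piecewise_C1_differentiable_on_def)
  have "(\<lambda>t. smul (vector_derivative g (at t within {0..1})) (G (g t))) integrable_on cbox 0 1"
  proof (rule integrable_on_little_subintervals, intro ballI)
    fix x :: real assume x: "x \<in> cbox 0 1"
    then have "g x \<in> S" using assms(3) by (auto simp: path_image_def)
    then obtain r where r: "r > 0" "ball (g x) r \<subseteq> S" using assms(1) open_contains_ball by blast
    obtain P where P: "\<And>s. s \<in> ball (g x) r \<Longrightarrow> (P has_derivative (\<lambda>h. smul h (G s))) (at s)"
    proof (rule local_primitive [of "ball (g x) r" "g x" G K])
      show "continuous_on (ball (g x) r) K" using K r(2) continuous_on_subset by blast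
    qed (use r G in auto)
    have "\<exists>d>0. \<forall>t\<in>{0..1}. dist t x < d \<longrightarrow> dist (g t) (g x) < r"
      using contg x r(1) by (auto simp: continuous_on_iff)
    then obtain d where d: "d > 0" "\<And>t. t \<in> {0..1} \<Longrightarrow> dist t x < d \<Longrightarrow> dist (g t) (g x) < r"
      by blast
    have "(\<lambda>t. smul (vector_derivative g (at t within {0..1})) (G (g t))) integrable_on cbox u v"
      if uv: "x \<in> cbox u v" "cbox u v \<subseteq> ball x d" "cbox u v \<subseteq> cbox 0 1" for u v
    proof -
      have "u \<le> v" using uv(1) by auto
      have near: "g t \<in> ball (g x) r" if "t \<in> {u..v}" for t
        using d(2) [of t] that uv(2,3) by (auto simp: dist_commute subset_iff)
      have "((\<lambda>t. smul (vector_derivative g (at t within {0..1})) (G (g t))) has_integral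
          (P (g v) - P (g u))) {u..v}"
      proof (rule fundamental_theorem_of_calculus_interior_strong [OF F(1) \<open>u \<le> v\<close>])
        fix t assume t: "t \<in> {u<..<v} - F"
        then have t01: "t \<in> {0<..<1}" "t \<in> {u..v}" using uv(3) \<open>u \<le> v\<close> by (auto simp: subset_iff) (smt (verit) atLeastAtMost_iff)+
        then have "g differentiable at t"
          using F(2) t by (auto simp: C1_differentiable_on_eq)
        moreover have "vector_derivative g (at t within {0..1}) = vector_derivative g (at t)"
          using t01 by (metis at_within_interior interior_atLeastAtMost_real)
        ultimately have "(g has_vector_derivative vector_derivative g (at t within {0..1})) (at t)"
          by (simp add: vector_derivative_works)
        from has_derivative_compose [OF this [unfolded has_vector_derivative_def] P [OF near [OF t01(2)]]]
        have "((\<lambda>t. P (g t)) has_derivative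
            (\<lambda>h. smul (h *\<^sub>R vector_derivative g (at t within {0..1})) (G (g t)))) (at t)" .
        then show "((\<lambda>t. P (g t)) has_vector_derivative
            smul (vector_derivative g (at t within {0..1})) (G (g t))) (at t)"
          by (simp add: has_vector_derivative_def smul.scaleR_left)
      next
        have "continuous_on (ball (g x) r) P"
          using P by (meson continuous_at_imp_continuous_on has_derivative_continuous)
        moreover have "continuous_on {u..v} g" using contg uv(3) continuous_on_subset by (metis box_real(2))
        ultimately show "continuous_on {u..v} (\<lambda>t. P (g t))"
          by (rule continuous_on_compose2) (use near in auto)
      qed
      then show ?thesis by auto
    qed
    then show "\<exists>d>0. \<forall>u v. x \<in> cbox u v \<and> cbox u v \<subseteq> ball x d \<and> cbox u v \<subseteq> cbox 0 1 \<longrightarrow>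
        (\<lambda>t. smul (vector_derivative g (at t within {0..1})) (G (g t))) integrable_on cbox u v"
      using d(1) by blast
  qed
  then show ?thesis by simp
qed

text \<open>Complex linearity of \<open>cfun\<close> turns \<open>smul h (K s)\<close> into
  \<open>h\<close> times a scalar.\<close>

lemma holomorphic_on_cfun:
  assumes "open S" "\<And>s. s \<in> S \<Longrightarrow> (G has_derivative (\<lambda>h. smul h (K s))) (at s)"
  shows "(\<lambda>s. cfun \<phi> (G s)) holomorphic_on S"
proof -
  have "((\<lambda>s. cfun \<phi> (G s)) has_field_derivative cfun \<phi> (K s)) (at s)" if "s \<in> S" for s
    using bounded_linear.has_derivative [OF bounded_linear_cfun assms(2) [OF that], of \<phi>]
    by (simp add: has_field_derivative_def cfun_smul mult_commute_abs)
  then show ?thesis using assms(1) by (auto simp: holomorphic_on_open)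
qed

lemma cfun_integral_along_path:
  assumes "(\<lambda>t. smul (vector_derivative g (at t within {0..1})) (G (g t))) integrable_on {0..1}"
  shows "cfun \<phi> (integral {0..1} (\<lambda>t. smul (vector_derivative g (at t within {0..1})) (G (g t))))
    = contour_integral g (\<lambda>s. cfun \<phi> (G s))"
  using has_integral_linear [OF integrable_integral [OF assms] bounded_linear_cfun, of \<phi>]
  by (intro contour_integral_unique [symmetric])
     (simp add: has_contour_integral_def o_def cfun_smul mult.commute)

end

section \<open>Slices and intrinsic functions\<close>

lemma imag_unit_square: "i \<in> imag_units \<Longrightarrow> i * i = - 1"
  by (simp add: imag_units_def power2_eq_square)

lemma norm_imag_unit:
  assumes "i \<in> imag_units"
  shows "norm i = 1"
proof -
  have "norm i * norm i = 1"
    using imag_unit_square [OF assms] by (metis norm_minus_cancel norm_mult norm_one)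
  then show ?thesis
    by (metis abs_norm_cancel abs_1 real_sqrt_abs2 real_sqrt_one)
qed

text \<open>The squares of the components sum to 1, and the square of \<open>qRe i\<close> minus the
  other three is the real part -1 of \<open>i * i\<close>; add the two.\<close>

lemma qRe_imag_unit:
  assumes "i \<in> imag_units"
  shows "qRe i = 0"
proof -
  have "(qRe i)\<^sup>2 + (qIm1 i)\<^sup>2 + (qIm2 i)\<^sup>2 + (qIm3 i)\<^sup>2 = 1"
    using norm_imag_unit [OF assms] by (simp add: norm_quat_def)
  moreover have "qRe (i * i) = - 1"
    using imag_unit_square [OF assms] by (simp add: quat_defs)
  ultimately have "qRe i * qRe i = 0"
    unfolding times_quat_def power2_eq_square quat.sel by linarith
  then show ?thesis by simp
qed

lemma imag_unit_uminus: "i \<in> imag_units \<Longrightarrow> - i \<in> imag_units"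
  by (simp add: imag_units_def)

lemma of_real_quat: "of_real r = Quat r 0 0 0"
  by (simp add: of_real_def quat_defs)

lemma slice_embed_eq: "slice_embed i z = Re z *\<^sub>R 1 + Im z *\<^sub>R i"
  by (simp add: slice_embed_def scaleR_conv_of_real)

lemma slice_embed_uminus: "slice_embed i (- z) = - slice_embed i z"
  by (simp add: slice_embed_eq)

lemma slice_embed_diff: "slice_embed i (z - w) = slice_embed i z - slice_embed i w"
  by (simp add: slice_embed_eq algebra_simps)

lemma slice_embed_of_real: "slice_embed i (of_real r) = of_real r"
  by (simp add: slice_embed_def)

lemma slice_embed_ii: "slice_embed i \<i> = i"
  by (simp add: slice_embed_def)

lemma bounded_linear_slice_embed: "bounded_linear (slice_embed i)"
  unfolding slice_embed_eq [abs_def] by (intro bounded_linear_intros bounded_linear_Re bounded_linear_Im)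

lemma continuous_on_slice_embed: "continuous_on A (slice_embed i)"
  by (intro linear_continuous_on bounded_linear_slice_embed)

lemma slice_embed_mult:
  assumes "i \<in> imag_units"
  shows "slice_embed i (z * w) = slice_embed i z * slice_embed i w"
  by (simp add: slice_embed_eq imag_unit_square [OF assms] algebra_simps)

lemma slice_embed_components:
  assumes "i \<in> imag_units"
  shows "qRe (slice_embed i z) = Re z" "qIm (slice_embed i z) = Im z *\<^sub>R i"
    "qcnj (slice_embed i z) = slice_embed i (cnj z)"
  by (simp_all add: slice_embed_eq qIm_def qcnj_def of_real_quat quat_defs qRe_imag_unit [OF assms])

lemma norm_slice_embed:
  assumes "i \<in> imag_units"
  shows "norm (slice_embed i z) = norm z"
proof -
  have *: "(qIm1 i)\<^sup>2 + (qIm2 i)\<^sup>2 + (qIm3 i)\<^sup>2 = 1"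
    using norm_imag_unit [OF assms] qRe_imag_unit [OF assms] by (simp add: norm_quat_def)
  have "norm (slice_embed i z) = sqrt ((Re z)\<^sup>2 + (Im z)\<^sup>2 * ((qIm1 i)\<^sup>2 + (qIm2 i)\<^sup>2 + (qIm3 i)\<^sup>2))"
    by (simp add: norm_quat_def slice_embed_eq quat_defs qRe_imag_unit [OF assms] power_mult_distrib
        algebra_simps)
  then show ?thesis by (simp add: * norm_complex_def)
qed

lemma inj_slice_embed: "i \<in> imag_units \<Longrightarrow> inj (slice_embed i)"
  by (rule injI) (metis norm_slice_embed slice_embed_diff norm_eq_zero right_minus_eq)

text \<open>Orthogonal imaginary units anticommute. The witness rotates the first two imaginary
  components of \<open>i\<close> by a right angle, or is the first basis unit when both
  vanish.\<close>

lemma anticommuting_imag_unit: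
  assumes "i \<in> imag_units"
  obtains j where "j \<in> imag_units" "j * i = - (i * j)"
proof -
  have i: "qRe i = 0" by (rule qRe_imag_unit [OF assms])
  define n where "n = (qIm1 i)\<^sup>2 + (qIm2 i)\<^sup>2"
  show ?thesis
  proof (cases "n = 0")
    case True
    then have "qIm1 i = 0" "qIm2 i = 0"
      by (simp_all add: n_def sum_power2_eq_zero_iff)
    with i show ?thesis
      by (intro that [of "Quat 0 1 0 0"])
         (simp_all add: imag_units_def power2_eq_square quat_defs quat_eq_iff)
  next
    case False
    then have "n > 0" by (simp add: n_def sum_power2_gt_zero_iff)
    define r where "r = sqrt n"
    have r: "r > 0" "r * r = n" using \<open>n > 0\<close> by (auto simp: r_def)
    have n: "qIm1 i * qIm1 i + qIm2 i * qIm2 i = r * r" by (simp add: r n_def power2_eq_square)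
    from i show ?thesis
    proof (intro that [of "Quat 0 (qIm2 i / r) (- qIm1 i / r) 0"])
      have "- (qIm2 i * qIm2 i / (r * r)) - qIm1 i * qIm1 i / (r * r) = - 1"
        using n r(1) by (simp add: field_simps)
      then show "Quat 0 (qIm2 i / r) (- qIm1 i / r) 0 \<in> imag_units"
        by (simp add: imag_units_def power2_eq_square quat_defs quat_eq_iff)
    qed (simp add: quat_defs quat_eq_iff)
  qed
qed

lemma slice_params_if_slice_embed_in:
  assumes "axially_symmetric U" "i \<in> imag_units" "slice_embed i z \<in> U"
  shows "(Re z, Im z) \<in> slice_params U"
  unfolding slice_params_def
proof (clarsimp)
  fix k assume k: "k \<in> imag_units"
  \<comment> \<open>\<open>qsphere\<close> uses the modulus of the imaginary part; the sign of
    \<open>Im z\<close> is absorbed into the unit.\<close>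
  define k' where "k' = (if Im z \<ge> 0 then k else - k)"
  have k': "k' \<in> imag_units" using k by (simp add: k'_def imag_unit_uminus)
  have "norm (qIm (slice_embed i z)) = \<bar>Im z\<bar>"
    by (simp add: slice_embed_components [OF assms(2)] norm_imag_unit [OF assms(2)])
  moreover have "of_real (qRe (slice_embed i z)) + of_real (norm (qIm (slice_embed i z))) * k' \<in> U"
    using assms(1,3) k' unfolding axially_symmetric_def qsphere_def by blast
  ultimately show "of_real (Re z) + of_real (Im z) * k \<in> U"
    by (auto simp: slice_embed_components [OF assms(2)] k'_def split: if_splits)
qed

section \<open>Intrinsic functions on a slice\<close>

locale intrinsic_restriction =
  fixes U f i
  assumes f: "intrinsic_slice_hyperholomorphic_on U f" and i: "i \<in> imag_units"
begin

text \<open>Real values of \<open>f0\<close> and \<open>f1\<close> keep \<open>f\<close> in the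
  plane of \<open>i\<close>, where \<open>slice_embed i\<close> can be inverted.\<close>

lemma components:
  obtains f0 f1 where "left_slice_components U f f0 f1"
    "\<And>z. slice_embed i z \<in> U \<Longrightarrow> (Re z, Im z) \<in> slice_params U"
    "\<And>z. slice_embed i z \<in> U \<Longrightarrow> f (slice_embed i z) = slice_embed i (Complex (qRe (f0 (Re z, Im z))) (qRe (f1 (Re z, Im z))))"
    "\<And>z. slice_embed i z \<in> U \<Longrightarrow> slice_restrict i f z = Complex (qRe (f0 (Re z, Im z))) (qRe (f1 (Re z, Im z)))"
proof -
  obtain f0 f1 where c: "left_slice_components U f f0 f1"
    and real: "\<And>p. p \<in> slice_params U \<Longrightarrow> f0 p \<in> \<real> \<and> f1 p \<in> \<real>"
    and ax: "axially_symmetric U"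
    using f unfolding intrinsic_slice_hyperholomorphic_on_def by blast
  have par: "(Re z, Im z) \<in> slice_params U" if "slice_embed i z \<in> U" for z
    using slice_params_if_slice_embed_in [OF ax i that] .
  have *: "f (slice_embed i z) = slice_embed i (Complex (qRe (f0 (Re z, Im z))) (qRe (f1 (Re z, Im z))))"
    if "slice_embed i z \<in> U" for z
  proof -
    have "f (slice_embed i z) = f0 (Re z, Im z) + i * f1 (Re z, Im z)"
      using c i that unfolding left_slice_components_def slice_embed_def by blast
    moreover have "f0 (Re z, Im z) = of_real (qRe (f0 (Re z, Im z)))"
        "f1 (Re z, Im z) = of_real (qRe (f1 (Re z, Im z)))"
      using real [OF par [OF that]] by (auto simp: of_real_quat elim!: Reals_cases)
    ultimately show ?thesis
      by (metis slice_embed_def complex.sel of_real_def mult_scaleR_left mult_scaleR_right mult_1 mult_1_right)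
  qed
  moreover have "slice_restrict i f z = Complex (qRe (f0 (Re z, Im z))) (qRe (f1 (Re z, Im z)))"
    if "slice_embed i z \<in> U" for z
    using * [OF that] by (simp add: slice_restrict_def inv_f_f [OF inj_slice_embed [OF i]])
  ultimately show ?thesis using that c par by blast
qed

lemma slice_embed_slice_restrict:
  "slice_embed i z \<in> U \<Longrightarrow> slice_embed i (slice_restrict i f z) = f (slice_embed i z)"
  by (metis components)

lemma slice_embed_cnj_in:
  assumes "slice_embed i z \<in> U"
  shows "slice_embed i (cnj z) \<in> U"
proof -
  have "(Re z, Im z) \<in> slice_params U" using components assms by metis
  then have "of_real (Re z) + of_real (Im z) * (- i) \<in> U"
    using imag_unit_uminus [OF i] by (auto simp: slice_params_def)
  then show ?thesis by (simp add: slice_embed_def)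
qed

text \<open>In the second argument \<open>f0\<close> is even and \<open>f1\<close> is odd.\<close>

lemma slice_restrict_cnj:
  assumes "slice_embed i z \<in> U"
  shows "slice_restrict i f (cnj z) = cnj (slice_restrict i f z)"
proof -
  obtain f0 f1 where c: "left_slice_components U f f0 f1"
    and par: "(Re z, Im z) \<in> slice_params U"
    and r: "\<And>z. slice_embed i z \<in> U \<Longrightarrow> slice_restrict i f z = Complex (qRe (f0 (Re z, Im z))) (qRe (f1 (Re z, Im z)))"
    using components assms by metis
  have "f0 (Re z, - Im z) = f0 (Re z, Im z)" "f1 (Re z, - Im z) = - f1 (Re z, Im z)"
    using c par by (auto simp: left_slice_components_def)
  then show ?thesis
    using r [OF assms] r [OF slice_embed_cnj_in [OF assms]] by (simp add: complex_eq_iff uminus_quat_def)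
qed

lemma open_slice: "open (slice_embed i -` U)"
  using f open_vimage [OF _ continuous_on_slice_embed]
  by (auto simp: intrinsic_slice_hyperholomorphic_on_def)

lemma bounded_linear_qRe: "bounded_linear qRe"
proof (rule bounded_linear_intro)
  show "norm (qRe x) \<le> norm x * 1" for x
    by (auto simp: norm_quat_def intro!: real_le_rsqrt)
qed (auto simp: quat_defs)

text \<open>For real components, the equations for \<open>f0\<close> and \<open>f1\<close> are the
  Cauchy-Riemann equations of \<open>f0 + \<i> * f1\<close>.\<close>

lemma holomorphic_slice_restrict: "slice_restrict i f holomorphic_on (slice_embed i -` U)"
proof -
  obtain f0 f1 where c: "left_slice_components U f f0 f1"
    and par: "\<And>z. slice_embed i z \<in> U \<Longrightarrow> (Re z, Im z) \<in> slice_params U"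
    and r: "\<And>z. slice_embed i z \<in> U \<Longrightarrow> slice_restrict i f z = Complex (qRe (f0 (Re z, Im z))) (qRe (f1 (Re z, Im z)))"
    using components by metis
  obtain f0' f1' :: "real \<times> real \<Rightarrow> (real \<times> real) \<Rightarrow>\<^sub>L quat" where
    d: "\<And>p. p \<in> slice_params U \<Longrightarrow> (f0 has_derivative blinfun_apply (f0' p)) (at p) \<and>
           (f1 has_derivative blinfun_apply (f1' p)) (at p) \<and>
           f0' p (1, 0) - f1' p (0, 1) = 0 \<and> f0' p (0, 1) + f1' p (1, 0) = 0"
    using c unfolding left_slice_components_def by meson
  define F where "F z = of_real (qRe (f0 (Re z, Im z))) + \<i> * of_real (qRe (f1 (Re z, Im z)))" for z
  have "\<exists>D. (F has_field_derivative D) (at z)" if "z \<in> slice_embed i -` U" for z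
  proof -
    let ?p = "(Re z, Im z)"
    have pU: "?p \<in> slice_params U" using par that by simp
    define a b where "a = qRe (f0' ?p (1, 0))" and "b = qRe (f0' ?p (0, 1))"
    have a: "qRe (f1' ?p (0, 1)) = a" and b: "qRe (f1' ?p (1, 0)) = - b"
      using d [OF pU] by (auto simp: a_def b_def quat_defs quat_eq_iff)
    have dp: "((\<lambda>z. (Re z, Im z)) has_derivative (\<lambda>h. (Re h, Im h))) (at z)"
      by (auto intro!: derivative_eq_intros)
    have lin: "blinfun_apply A (Re h, Im h) = Re h *\<^sub>R A (1, 0) + Im h *\<^sub>R A (0, 1)"
      for A :: "(real \<times> real) \<Rightarrow>\<^sub>L quat" and h
      by (simp flip: blinfun.scaleR_right blinfun.add_right)
    note comp = bounded_linear.has_derivative [OF bounded_linear_qRe has_derivative_compose [OF dp]]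
    have "(F has_derivative (\<lambda>h. of_real (qRe (f0' ?p (Re h, Im h))) + \<i> * of_real (qRe (f1' ?p (Re h, Im h))))) (at z)"
      unfolding F_def [abs_def]
      by (intro has_derivative_add has_derivative_mult_right has_derivative_of_real comp)
         (use d [OF pU] in auto)
    moreover have "of_real (qRe (f0' ?p (Re h, Im h))) + \<i> * of_real (qRe (f1' ?p (Re h, Im h)))
        = (of_real a - \<i> * of_real b) * h" for h
      using a b by (simp add: lin quat_defs a_def [symmetric] b_def [symmetric] complex_eq_iff algebra_simps)
    ultimately show ?thesis
      by (auto simp: has_field_derivative_def intro: exI [of _ "of_real a - \<i> * of_real b"])
  qed
  then have "F holomorphic_on (slice_embed i -` U)"
    using open_slice by (simp add: holomorphic_on_open)
  then show ?thesis
    by (rule holomorphic_transform) (use r in \<open>auto simp: F_def complex_eq_iff\<close>)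
qed

end

section \<open>The resolvent on a slice\<close>

text \<open>The equation \<open>x = y + N x\<close> has a unique solution by the contraction
  principle; the solution map is the inverse.\<close>

lemma id_minus_contraction_invertible:
  fixes N :: "'a :: banach \<Rightarrow>\<^sub>L 'a"
  assumes "norm N < 1"
  obtains M where "(id_blinfun - N) o\<^sub>L M = id_blinfun" "M o\<^sub>L (id_blinfun - N) = id_blinfun"
proof -
  have ex1: "\<exists>!x. y + N x = x" for y
  proof (rule banach_fix_type)
    show "\<forall>x z. dist (y + N x) (y + N z) \<le> norm N * dist x z"
      by (auto simp: dist_norm norm_blinfun simp flip: blinfun.diff_right)
  qed (use assms in auto)
  define m where "m y = (THE x. y + N x = x)" for y
  have m: "y + N (m y) = m y" for y
    unfolding m_def by (rule theI' [OF ex1])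
  have m_unique: "m y = x" if "y + N x = x" for x y
    using ex1 m that by blast
  have "bounded_linear m"
  proof (rule bounded_linear_intro)
    show "m (x + y) = m x + m y" for x y
      by (rule m_unique) (metis (no_types, lifting) m add.assoc add.left_commute blinfun.add_right)
    show "m (r *\<^sub>R x) = r *\<^sub>R m x" for r x
      by (rule m_unique) (metis m scaleR_add_right blinfun.scaleR_right)
    show "norm (m y) \<le> norm y * (1 / (1 - norm N))" for y
    proof -
      have "norm (m y) \<le> norm y + norm N * norm (m y)"
        using m [of y] norm_triangle_le [OF add_left_mono [OF norm_blinfun]] by metis
      then have "(1 - norm N) * norm (m y) \<le> norm y" by (simp add: algebra_simps)
      then show ?thesis using assms by (simp add: field_simps)
    qed
  qed
  then have M: "blinfun_apply (Blinfun m) = m" by (rule bounded_linear_Blinfun_apply)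
  show ?thesis
  proof (rule that)
    show "(id_blinfun - N) o\<^sub>L Blinfun m = id_blinfun"
      by (rule blinfun_eqI) (use m in \<open>simp add: M blinfun.diff_left algebra_simps\<close>)
    show "Blinfun m o\<^sub>L (id_blinfun - N) = id_blinfun"
      by (rule blinfun_eqI) (simp add: M blinfun.diff_left m_unique)
  qed
qed

text \<open>Factor \<open>E = (id_blinfun - N) o\<^sub>L A\<close> with
  \<open>N = (A - E) o\<^sub>L B\<close> and invert both factors.\<close>

lemma invertible_perturbation:
  fixes A B E :: "'a :: banach \<Rightarrow>\<^sub>L 'a"
  assumes "A o\<^sub>L B = id_blinfun" "B o\<^sub>L A = id_blinfun" "norm (A - E) * norm B < 1"
  obtains E' where "E o\<^sub>L E' = id_blinfun" "E' o\<^sub>L E = id_blinfun"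
proof -
  define N where "N = (A - E) o\<^sub>L B"
  have "norm N < 1"
    unfolding N_def using norm_blinfun_compose [of "A - E" B] assms(3) by linarith
  then obtain M where M: "(id_blinfun - N) o\<^sub>L M = id_blinfun" "M o\<^sub>L (id_blinfun - N) = id_blinfun"
    by (rule id_minus_contraction_invertible)
  have BA: "blinfun_apply B (blinfun_apply A x) = x" "blinfun_apply A (blinfun_apply B x) = x" for x
    using assms(1,2) by (metis blinfun_apply_blinfun_compose id_blinfun.rep_eq)+
  have EN: "E = (id_blinfun - N) o\<^sub>L A"
    by (rule blinfun_eqI) (simp add: N_def blinfun.diff_left BA)
  have Mx: "blinfun_apply M x - blinfun_apply N (blinfun_apply M x) = x"
      "blinfun_apply M (x - blinfun_apply N x) = x" for x
    using M by (metis blinfun_apply_blinfun_compose id_blinfun.rep_eq blinfun.diff_left)+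
  show ?thesis
  proof (rule that [of "B o\<^sub>L M"])
    show "E o\<^sub>L (B o\<^sub>L M) = id_blinfun"
      by (rule blinfun_eqI) (simp add: EN BA Mx blinfun.diff_left)
    show "(B o\<^sub>L M) o\<^sub>L E = id_blinfun"
      by (rule blinfun_eqI) (simp add: EN BA Mx blinfun.diff_left)
  qed
qed

text \<open>Caratheodory's criterion: the remainder \<open>prod (t - s) (H t - H s)\<close> is small
  relative to \<open>t - s\<close>.\<close>

lemma (in bounded_bilinear) has_derivative_Caratheodory:
  assumes "eventually (\<lambda>t. F t - F s = prod (t - s) (H t)) (at s)" "(H \<longlongrightarrow> H s) (at s)"
  shows "(F has_derivative (\<lambda>h. prod h (H s))) (at s)"
proof -
  obtain K where K: "\<And>a b. norm (prod a b) \<le> norm a * norm b * K" using bounded by blast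
  have "((\<lambda>t. norm (prod (t - s) (H t - H s)) / norm (t - s)) \<longlongrightarrow> 0) (at s)"
  proof (rule Lim_null_comparison)
    show "\<forall>\<^sub>F t in at s. norm (norm (prod (t - s) (H t - H s)) / norm (t - s)) \<le> norm (H t - H s) * K"
      using eventually_at_filter
      by (auto simp: eventually_at_filter divide_simps mult_ac intro!: always_eventually K [THEN order_trans])
    show "((\<lambda>t. norm (H t - H s) * K) \<longlongrightarrow> 0) (at s)"
      using tendsto_mult_left_zero [OF tendsto_norm_zero [OF LIM_zero [OF assms(2)]]] by simp
  qed
  moreover have "\<forall>\<^sub>F t in at s. norm (prod (t - s) (H t - H s)) / norm (t - s)
      = norm (F t - F s - prod (t - s) (H s)) / norm (t - s)"
    using assms(1) by eventually_elim (simp add: diff_right)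
  ultimately have "((\<lambda>t. norm (F t - F s - prod (t - s) (H s)) / norm (t - s)) \<longlongrightarrow> 0) (at s)"
    by (rule Lim_transform_eventually)
  then show ?thesis
    by (simp add: has_derivative_iff_norm bounded_linear_left)
qed

lemma right_mult_eq: "blinfun_apply (right_mult q) x = x \<star>\<^sub>r q" by transfer simp
lemma left_mult_eq: "blinfun_apply (left_mult q) x = q \<star>\<^sub>l x" by transfer simp

lemma rscale_scaleR: "x \<star>\<^sub>r (r *\<^sub>R q) = r *\<^sub>R (x \<star>\<^sub>r q)"
  by (metis mult.right_neutral mult_scaleR_right of_real_def rscale_mult rscale_of_real)

lemma lscale_scaleR: "(r *\<^sub>R q) \<star>\<^sub>l x = r *\<^sub>R (q \<star>\<^sub>l x)"
  by (metis mult_1 mult_scaleR_left of_real_def lscale_mult lscale_of_real)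

lemma rscale_1: "x \<star>\<^sub>r 1 = x" using rscale_of_real [of x 1] by simp
lemma lscale_1: "1 \<star>\<^sub>l x = x" using lscale_of_real [of 1 x] by simp

lemma rscale_slice_embed: "x \<star>\<^sub>r slice_embed i z = Re z *\<^sub>R x + Im z *\<^sub>R (x \<star>\<^sub>r i)"
  by (simp add: slice_embed_eq rscale_add_right rscale_scaleR rscale_1)

lemma lscale_slice_embed: "slice_embed i z \<star>\<^sub>l x = Re z *\<^sub>R x + Im z *\<^sub>R (i \<star>\<^sub>l x)"
  by (simp add: slice_embed_eq lscale_add_left lscale_scaleR lscale_1)

lemma inverse_in_eqI:
  assumes "is_inverse_in B A A'"
  shows "inverse_in B A = A'"
  unfolding inverse_in_def
proof (rule the_equality)
  show "is_inverse_in B A A'" by (rule assms)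
  fix C assume C: "is_inverse_in B A C"
  have "C x = A' x" for x
  proof -
    have "blinfun_apply C (blinfun_apply A (blinfun_apply A' x)) = blinfun_apply C x"
      using assms by (metis is_inverse_in_def blinfun_apply_blinfun_compose id_blinfun.rep_eq)
    then show ?thesis
      using C by (metis is_inverse_in_def blinfun_apply_blinfun_compose id_blinfun.rep_eq)
  qed
  then show "C = A'" by (rule blinfun_eqI)
qed

lemma inverse_in_B_R:
  assumes "A \<in> B_R" "A o\<^sub>L A' = id_blinfun" "A' o\<^sub>L A = id_blinfun"
  shows "A' \<in> B_R"
  unfolding B_R_def
proof (intro CollectI allI)
  fix x q
  have *: "blinfun_apply A (blinfun_apply A' y) = y" "blinfun_apply A' (blinfun_apply A y) = y" for y
    using assms(2,3) by (metis blinfun_apply_blinfun_compose id_blinfun.rep_eq)+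
  have "blinfun_apply A' (x \<star>\<^sub>r q) = blinfun_apply A' (blinfun_apply A (blinfun_apply A' x \<star>\<^sub>r q))"
    using assms(1) * by (simp add: B_R_def)
  then show "blinfun_apply A' (x \<star>\<^sub>r q) = blinfun_apply A' x \<star>\<^sub>r q" by (simp add: *)
qed

text \<open>Inverses inherit right linearity, so invertibility can be decided among all bounded real
  linear operators, where the perturbation argument works.\<close>

lemma invertible_in_B_R_iff:
  assumes "A \<in> B_R"
  shows "invertible_in B_R A \<longleftrightarrow> (\<exists>A'. A o\<^sub>L A' = id_blinfun \<and> A' o\<^sub>L A = id_blinfun)"
  using assms inverse_in_B_R by (auto simp: invertible_in_def is_inverse_in_def)

text \<open>Bundled as a bounded operator on operators so that it can serve as
  \<open>J\<close>.\<close>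

definition post_right_mult :: "quat \<Rightarrow> ('x :: two_sided_quat_banach \<Rightarrow>\<^sub>L 'x) \<Rightarrow>\<^sub>L ('x \<Rightarrow>\<^sub>L 'x)" where
  "post_right_mult q = Blinfun (\<lambda>V. right_mult q o\<^sub>L V)"

lemma post_right_mult_apply: "blinfun_apply (post_right_mult q) V = right_mult q o\<^sub>L V"
  unfolding post_right_mult_def
  by (rule bounded_linear_Blinfun_apply [THEN fun_cong])
     (rule bounded_bilinear.bounded_linear_right [OF bounded_bilinear_blinfun_compose])

section \<open>The resolvent of \<open>T\<close> in the plane of \<open>i\<close>\<close>

locale slice_operator =
  fixes T :: "'x :: two_sided_quat_banach \<Rightarrow>\<^sub>L 'x" and i j :: quat
  assumes T: "T \<in> B_R" and i: "i \<in> imag_units" and j: "j \<in> imag_units" and ji: "j * i = - (i * j)"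
begin

sublocale complex_structure "post_right_mult i :: ('x \<Rightarrow>\<^sub>L 'x) \<Rightarrow>\<^sub>L ('x \<Rightarrow>\<^sub>L 'x)"
proof
  fix V :: "'x \<Rightarrow>\<^sub>L 'x"
  show "blinfun_apply (post_right_mult i) (blinfun_apply (post_right_mult i) V) = - V"
  proof (rule blinfun_eqI)
    fix x
    have "(y \<star>\<^sub>r i) \<star>\<^sub>r i = - y" for y :: 'x
      using rscale_scaleR [of y "- 1" 1] by (simp add: imag_unit_square [OF i] rscale_1 flip: rscale_mult)
    then show "blinfun_apply (blinfun_apply (post_right_mult i) (blinfun_apply (post_right_mult i) V)) x = blinfun_apply (- V) x"
      by (simp add: post_right_mult_apply right_mult_eq blinfun.minus_left)
  qed
qed

abbreviation emb where "emb \<equiv> slice_embed i"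

lemma smul_apply: "blinfun_apply (smul c V) x = blinfun_apply V x \<star>\<^sub>r emb c"
  by (simp add: smul_def post_right_mult_apply right_mult_eq rscale_slice_embed
      blinfun.add_left blinfun.scaleR_left)

lemma smul_eq: "smul c V = slice_op_scale i c V"
  by (rule blinfun_eqI) (simp add: smul_apply slice_op_scale_def right_mult_eq)

lemma j_emb: "j * emb z = emb (cnj z) * j"
  by (simp add: slice_embed_eq algebra_simps ji)

lemma emb_j: "emb z * j = j * emb (cnj z)"
  using j_emb [of "cnj z"] by simp

lemma jj: "j * j = - 1" using j by (rule imag_unit_square)

lemma T_rscale: "T (x \<star>\<^sub>r q) = T x \<star>\<^sub>r q"
  using T by (simp add: B_R_def)

lemma Q_op_emb: "Q_op (emb s) T = (T o\<^sub>L T) - (2 * Re s) *\<^sub>R T + (norm s)\<^sup>2 *\<^sub>R id_blinfun"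
  by (simp add: Q_op_def slice_embed_components [OF i] norm_slice_embed [OF i])

lemma blinfun_rscale_scaleR: "(r *\<^sub>R x) \<star>\<^sub>r q = r *\<^sub>R (x \<star>\<^sub>r q)" for x :: 'x
  by (metis blinfun.scaleR_right right_mult_eq)

lemma rscale_diff_left: "(x - y) \<star>\<^sub>r q = x \<star>\<^sub>r q - y \<star>\<^sub>r q" for x y :: 'x
  by (metis blinfun.diff_right right_mult_eq)

lemma rscale_minus_left: "(- x) \<star>\<^sub>r q = - (x \<star>\<^sub>r q)" for x :: 'x
  by (metis blinfun.minus_right right_mult_eq)

lemma Q_op_in_B_R: "Q_op (emb s) T \<in> B_R"
  by (simp add: B_R_def Q_op_emb blinfun.diff_left blinfun.add_left blinfun.scaleR_left T_rscale
      rscale_add_left rscale_diff_left blinfun_rscale_scaleR)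

definition \<Omega> where "\<Omega> = emb -` S_resolvent_set T"

text \<open>\<open>Q_op\<close> depends on \<open>s\<close> only through \<open>Re s\<close> and
  \<open>norm s\<close>.\<close>

lemma cnj_\<Omega>: "cnj s \<in> \<Omega> \<longleftrightarrow> s \<in> \<Omega>"
  by (simp add: \<Omega>_def S_resolvent_set_def Q_op_emb)

text \<open>\<open>Q_op (emb z) T\<close> is norm continuous in \<open>z\<close>, and invertibility
  survives small perturbations.\<close>

lemma open_\<Omega>: "open \<Omega>"
proof (rule openI)
  fix s assume "s \<in> \<Omega>"
  then obtain B where B: "Q_op (emb s) T o\<^sub>L B = id_blinfun" "B o\<^sub>L Q_op (emb s) T = id_blinfun"
    by (auto simp: \<Omega>_def S_resolvent_set_def invertible_in_B_R_iff [OF Q_op_in_B_R])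
  let ?V = "(\<lambda>z. norm (Q_op (emb s) T - Q_op (emb z) T) * norm B) -` {..<1}"
  have "open ?V"
    unfolding Q_op_emb by (intro open_vimage continuous_intros open_lessThan)
  moreover have "s \<in> ?V" by simp
  moreover have "?V \<subseteq> \<Omega>"
  proof
    fix z assume "z \<in> ?V"
    then obtain E' where "Q_op (emb z) T o\<^sub>L E' = id_blinfun" "E' o\<^sub>L Q_op (emb z) T = id_blinfun"
      using invertible_perturbation [OF B, of "Q_op (emb z) T"] by auto
    then show "z \<in> \<Omega>"
      by (auto simp: \<Omega>_def S_resolvent_set_def invertible_in_B_R_iff [OF Q_op_in_B_R])
  qed
  ultimately show "\<exists>e>0. ball s e \<subseteq> \<Omega>" by (meson open_contains_ball subset_trans)
qed

definition Qinv where "Qinv s = inverse_in B_R (Q_op (emb s) T)"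

lemma Qinv_cnj: "Qinv (cnj s) = Qinv s"
  by (simp add: Qinv_def Q_op_emb)

lemma Qinv:
  assumes "s \<in> \<Omega>"
  shows "Qinv s \<in> B_R" "Q_op (emb s) T o\<^sub>L Qinv s = id_blinfun" "Qinv s o\<^sub>L Q_op (emb s) T = id_blinfun"
proof -
  obtain A where A: "is_inverse_in B_R (Q_op (emb s) T) A"
    using assms by (auto simp: \<Omega>_def S_resolvent_set_def invertible_in_def)
  then have "Qinv s = A" unfolding Qinv_def by (rule inverse_in_eqI)
  with A show "Qinv s \<in> B_R" "Q_op (emb s) T o\<^sub>L Qinv s = id_blinfun" "Qinv s o\<^sub>L Q_op (emb s) T = id_blinfun"
    by (auto simp: is_inverse_in_def)
qed

lemma Qinv_rscale: "s \<in> \<Omega> \<Longrightarrow> Qinv s (x \<star>\<^sub>r q) = Qinv s x \<star>\<^sub>r q"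
  using Qinv(1) by (simp add: B_R_def)

text \<open>\<open>Q_op\<close> is a real polynomial in \<open>T\<close>, so it commutes with
  \<open>T\<close>, and hence so does its inverse.\<close>

lemma Qinv_T:
  assumes "s \<in> \<Omega>"
  shows "Qinv s (T x) = T (Qinv s x)"
proof -
  have *: "Q_op (emb s) T (Qinv s y) = y" "Qinv s (Q_op (emb s) T y) = y" for y
    using Qinv(2,3) [OF assms] by (metis blinfun_apply_blinfun_compose id_blinfun.rep_eq)+
  have "Q_op (emb s) T (T y) = T (Q_op (emb s) T y)" for y
    by (simp add: Q_op_emb blinfun.diff_left blinfun.add_left blinfun.scaleR_left
        blinfun.diff_right blinfun.add_right blinfun.scaleR_right)
  then show ?thesis by (metis *)
qed

text \<open>\<open>T\<close> commutes with right multiplications, so the product expands with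
  coefficients \<open>2 * Re s\<close> and \<open>(norm s)\<^sup>2\<close>, the sum and the product
  of \<open>s\<close> and its conjugate.\<close>

lemma Delta_Delta: "Delta (emb s) T (Delta (emb (cnj s)) T x) = Q_op (emb s) T x"
proof -
  have "x \<star>\<^sub>r emb (cnj s) \<star>\<^sub>r emb s = (norm s)\<^sup>2 *\<^sub>R x"
  proof -
    have "emb (cnj s) * emb s = of_real ((norm s)\<^sup>2)"
      by (metis slice_embed_mult [OF i] slice_embed_of_real complex_norm_square mult.commute)
    then show ?thesis by (simp only: rscale_of_real flip: rscale_mult)
  qed
  moreover have "y \<star>\<^sub>r emb s + y \<star>\<^sub>r emb (cnj s) = (2 * Re s) *\<^sub>R y" for y :: 'x
    by (simp add: rscale_slice_embed algebra_simps flip: scaleR_left_distrib)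
  then have "T x \<star>\<^sub>r emb s = (2 * Re s) *\<^sub>R T x - T x \<star>\<^sub>r emb (cnj s)"
    by (metis add_diff_cancel_right')
  ultimately show ?thesis
    by (simp add: Delta_def Q_op_emb blinfun.diff_left blinfun.diff_right blinfun.add_left
        blinfun.scaleR_left right_mult_eq T_rscale rscale_diff_left)
qed

definition Res where "Res s = Qinv s o\<^sub>L Delta (emb (cnj s)) T"

lemma Res_apply: "Res s x = Qinv s (x \<star>\<^sub>r emb (cnj s)) - Qinv s (T x)"
  by (simp add: Res_def Delta_def blinfun.diff_left blinfun.diff_right right_mult_eq)

text \<open>\<open>Delta_Delta\<close> at \<open>cnj s\<close> gives the left inverse; as
  \<open>Qinv s\<close> commutes with \<open>Delta (emb s) T\<close>, \<open>Delta_Delta\<close> at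
  \<open>s\<close> gives the right one.\<close>

lemma Res_Delta:
  assumes "s \<in> \<Omega>"
  shows "Res s (Delta (emb s) T x) = x" "Delta (emb s) T (Res s x) = x"
proof -
  have *: "Qinv s (Q_op (emb s) T y) = y" for y
    using Qinv(3) [OF assms] by (metis blinfun_apply_blinfun_compose id_blinfun.rep_eq)
  have "Q_op (emb (cnj s)) T = Q_op (emb s) T" by (simp add: Q_op_emb)
  then show "Res s (Delta (emb s) T x) = x"
    using Delta_Delta [of "cnj s" x] by (simp add: Res_def *)
  have "Delta (emb s) T (Qinv s y) = Qinv s (Delta (emb s) T y)" for y
    by (simp add: Delta_def blinfun.diff_left blinfun.diff_right right_mult_eq Qinv_T [OF assms] Qinv_rscale [OF assms])
  then show "Delta (emb s) T (Res s x) = x"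
    by (simp add: Res_def Delta_Delta *)
qed

lemma Res_rscale:
  assumes "s \<in> \<Omega>"
  shows "Res s (x \<star>\<^sub>r emb z) = Res s x \<star>\<^sub>r emb z"
proof -
  have "emb z * emb (cnj s) = emb (cnj s) * emb z"
    by (metis slice_embed_mult [OF i] mult.commute)
  then show ?thesis
    by (simp add: Res_apply Qinv_rscale [OF assms] T_rscale rscale_diff_left flip: rscale_mult)
qed

lemma inverse_in_Delta: "s \<in> \<Omega> \<Longrightarrow> inverse_in (B_slice i) (Delta (emb s) T) = Res s"
  by (intro inverse_in_eqI)
     (auto simp: is_inverse_in_def B_slice_def Res_rscale Res_Delta intro!: blinfun_eqI)

text \<open>\<open>Delta\<close> at \<open>s\<close> and at \<open>t\<close> differ by right
  multiplications only; evaluate the difference at \<open>Res s x\<close> and apply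
  \<open>Res t\<close>.\<close>

lemma resolvent_identity:
  assumes "s \<in> \<Omega>" "t \<in> \<Omega>"
  shows "Res t - Res s = smul (t - s) (- (Res t o\<^sub>L Res s))"
proof (rule blinfun_eqI)
  fix x
  let ?y = "Res s x"
  have "Delta (emb s) T ?y - Delta (emb t) T ?y = ?y \<star>\<^sub>r emb s - ?y \<star>\<^sub>r emb t"
    by (simp add: Delta_def blinfun.diff_left right_mult_eq)
  then have "Res t (Delta (emb s) T ?y) - Res t (Delta (emb t) T ?y) = Res t ?y \<star>\<^sub>r emb s - Res t ?y \<star>\<^sub>r emb t"
    by (metis blinfun.diff_right Res_rscale assms(2))
  then have "Res t x - Res s x = Res t ?y \<star>\<^sub>r emb s - Res t ?y \<star>\<^sub>r emb t"
    by (simp add: Res_Delta assms)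
  then show "blinfun_apply (Res t - Res s) x = blinfun_apply (smul (t - s) (- (Res t o\<^sub>L Res s))) x"
    by (simp add: smul_apply blinfun.diff_left blinfun.minus_left rscale_slice_embed rscale_minus_left algebra_simps)
qed

text \<open>The resolvent identity bounds the difference by
  \<open>norm (t - s) * norm (Res t) * c\<close>. Once \<open>norm (t - s) * c < 1/2\<close>,
  absorption gives \<open>norm (Res t) \<le> 2 * norm (Res s)\<close>, so the bound tends to
  0.\<close>

lemma Res_tendsto:
  assumes "s \<in> \<Omega>"
  shows "(Res \<longlongrightarrow> Res s) (at s)"
proof -
  obtain K where K: "K > 0" "\<And>a b. norm (smul a b) \<le> norm a * norm b * K"
    using smul.pos_bounded by blast
  define c where "c = K * norm (Res s)"
  have "c \<ge> 0" using K by (simp add: c_def)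
  have diff: "norm (Res t - Res s) \<le> norm (t - s) * norm (Res t) * c" if "t \<in> \<Omega>" for t
  proof -
    have "norm (Res t - Res s) \<le> norm (t - s) * norm (Res t o\<^sub>L Res s) * K"
      unfolding resolvent_identity [OF assms that] using K(2) [of "t - s" "- (Res t o\<^sub>L Res s)"] by simp
    also have "\<dots> \<le> norm (t - s) * (norm (Res t) * norm (Res s)) * K"
      using K(1) by (intro mult_right_mono mult_left_mono norm_blinfun_compose) auto
    finally show ?thesis by (simp add: c_def mult_ac)
  qed
  have near: "\<forall>\<^sub>F t in at s. t \<in> \<Omega> \<and> norm (t - s) * c < 1/2"
  proof (rule eventually_conj)
    show "\<forall>\<^sub>F t in at s. t \<in> \<Omega>"
      using open_\<Omega> assms by (intro eventually_at_in_open') auto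
    have "((\<lambda>t. norm (t - s) * c) \<longlongrightarrow> norm (s - s) * c) (at s)"
      by (intro tendsto_intros)
    then show "\<forall>\<^sub>F t in at s. norm (t - s) * c < 1/2"
      by (intro order_tendstoD(2)) auto
  qed
  have "((\<lambda>t. Res t - Res s) \<longlongrightarrow> 0) (at s)"
  proof (rule Lim_null_comparison)
    show "((\<lambda>t. norm (t - s) * (2 * norm (Res s) * c)) \<longlongrightarrow> 0) (at s)"
      by (auto intro!: tendsto_eq_intros)
    show "\<forall>\<^sub>F t in at s. norm (Res t - Res s) \<le> norm (t - s) * (2 * norm (Res s) * c)"
      using near
    proof eventually_elim
      case (elim t)
      have "norm (Res t) \<le> norm (Res s) + norm (Res t - Res s)"
        by (metis norm_triangle_sub add.commute)
      also have "norm (Res t - Res s) \<le> norm (Res t) * (norm (t - s) * c)"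
        using diff elim by (simp add: mult_ac)
      also have "\<dots> \<le> norm (Res t) * (1/2)"
        using elim by (intro mult_left_mono) auto
      finally have "norm (Res t) \<le> 2 * norm (Res s)" by simp
      then have "norm (t - s) * norm (Res t) * c \<le> norm (t - s) * (2 * norm (Res s)) * c"
        using \<open>c \<ge> 0\<close> by (intro mult_right_mono mult_left_mono) auto
      with diff [of t] elim show ?case by (simp add: mult_ac)
    qed
  qed
  then show ?thesis by (rule LIM_zero_cancel)
qed

lemma Res_has_derivative:
  assumes "s \<in> \<Omega>"
  shows "(Res has_derivative (\<lambda>h. smul h (- (Res s o\<^sub>L Res s)))) (at s)"
proof (rule smul.has_derivative_Caratheodory [where H = "\<lambda>t. - (Res t o\<^sub>L Res s)"])
  have "\<forall>\<^sub>F t in at s. t \<in> \<Omega>"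
    using open_\<Omega> assms by (intro eventually_at_in_open') auto
  then show "\<forall>\<^sub>F t in at s. Res t - Res s = smul (t - s) (- (Res t o\<^sub>L Res s))"
    by eventually_elim (rule resolvent_identity [OF assms])
  show "((\<lambda>t. - (Res t o\<^sub>L Res s)) \<longlongrightarrow> - (Res s o\<^sub>L Res s)) (at s)"
    by (intro tendsto_intros Res_tendsto assms)
qed

text \<open>Conjugation by right multiplication with \<open>j\<close>. It is antilinear for the complex structure
  because \<open>j\<close> anticommutes with \<open>i\<close>.\<close>

definition Conj :: "('x \<Rightarrow>\<^sub>L 'x) \<Rightarrow> ('x \<Rightarrow>\<^sub>L 'x)" where
  "Conj V = right_mult (- j) o\<^sub>L V o\<^sub>L right_mult j"

lemma Conj_apply: "Conj V x = V (x \<star>\<^sub>r j) \<star>\<^sub>r (- j)"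
  by (simp add: Conj_def right_mult_eq)

lemma bounded_linear_Conj: "bounded_linear Conj"
  unfolding Conj_def
  by (intro bounded_linear_compose [OF bounded_bilinear.bounded_linear_left [OF bounded_bilinear_blinfun_compose]]
        bounded_bilinear.bounded_linear_right [OF bounded_bilinear_blinfun_compose])

lemma Conj_smul: "Conj (smul c V) = smul (cnj c) (Conj V)"
  by (rule blinfun_eqI) (simp add: Conj_apply smul_apply emb_j flip: rscale_mult)

text \<open>\<open>Qinv s\<close> and \<open>T\<close> are right linear, so \<open>j\<close> and
  \<open>- j\<close> cancel except around \<open>emb (cnj s)\<close>, which they turn into
  \<open>emb s\<close>.\<close>

lemma Conj_Res:
  assumes "s \<in> \<Omega>"
  shows "Conj (Res s) = Res (cnj s)"
proof (rule blinfun_eqI)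
  fix x
  have "j * emb (cnj s) * (- j) = emb s"
    by (simp add: j_emb mult.assoc jj)
  moreover have "j * (- j) = 1" by (simp add: jj)
  ultimately show "Conj (Res s) x = Res (cnj s) x"
    by (simp add: Conj_apply Res_apply Qinv_cnj Qinv_rscale [OF assms] Qinv_T [OF assms] T_rscale
        rscale_diff_left rscale_1 flip: rscale_mult)
qed

end

section \<open>Comparison of the two calculi\<close>

lemma sum_list_bounded_linear:
  assumes "bounded_linear L"
  shows "L (\<Sum>x\<leftarrow>xs. F x) = (\<Sum>x\<leftarrow>xs. L (F x))"
proof -
  interpret bounded_linear L by fact
  show ?thesis by (induction xs) (auto simp: add zero)
qed

locale slice_calculus = slice_operator T i j + intrinsic_restriction U f i
  for T :: "'x :: two_sided_quat_banach \<Rightarrow>\<^sub>L 'x" and i j :: quat and U f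
begin

definition S where "S = emb -` U \<inter> \<Omega>"

lemma open_S: "open S"
  unfolding S_def by (intro open_Int open_slice open_\<Omega>)

lemma cnj_S: "cnj s \<in> S \<longleftrightarrow> s \<in> S"
  unfolding S_def using slice_embed_cnj_in [of s] slice_embed_cnj_in [of "cnj s"] by (auto simp: cnj_\<Omega>)

abbreviation fi where "fi \<equiv> slice_restrict i f"

text \<open>With \<open>f\<close> absorbed, both integrands depend on \<open>ds\<close> only through
  \<open>smul ds (G s)\<close>.\<close>

definition G where "G s = smul (fi s) (Res s)"

definition G' where "G' s = smul (deriv fi s) (Res s) + smul (fi s) (- (Res s o\<^sub>L Res s))"

lemma G_has_derivative:
  assumes "s \<in> S"
  shows "(G has_derivative (\<lambda>h. smul h (G' s))) (at s)"
proof -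
  have "(fi has_field_derivative deriv fi s) (at s)"
    using holomorphic_slice_restrict open_slice assms by (intro holomorphic_derivI) (auto simp: S_def)
  then have "(fi has_derivative (\<lambda>h. deriv fi s * h)) (at s)"
    by (simp add: has_field_derivative_def)
  from smul.FDERIV [OF this Res_has_derivative] assms
  have "(G has_derivative (\<lambda>h. smul (fi s) (smul h (- (Res s o\<^sub>L Res s))) + smul (deriv fi s * h) (Res s))) (at s)"
    by (simp add: G_def [abs_def] S_def)
  moreover have "smul (fi s) (smul h (- (Res s o\<^sub>L Res s))) + smul (deriv fi s * h) (Res s) = smul h (G' s)" for h
    by (simp add: G'_def smul.add_right smul_smul mult.commute add.commute)
  ultimately show ?thesis by simp
qed

lemma continuous_on_G': "continuous_on S G'"
proof -
  have "continuous_on S Res"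
    using Res_has_derivative by (auto simp: S_def intro!: continuous_at_imp_continuous_on has_derivative_continuous)
  moreover have "continuous_on S fi" "continuous_on S (deriv fi)"
    using holomorphic_slice_restrict open_slice
    by (auto simp: S_def intro!: holomorphic_on_imp_continuous_on holomorphic_on_subset [OF holomorphic_slice_restrict]
          holomorphic_on_subset [OF holomorphic_deriv [OF holomorphic_slice_restrict open_slice]])
  ultimately show ?thesis
    unfolding G'_def
    by (intro continuous_intros smul.continuous_on)
qed

text \<open>Intrinsic functions commute with conjugation, and \<open>Conj\<close> is
  antilinear.\<close>

lemma Conj_G: "s \<in> S \<Longrightarrow> Conj (G s) = G (cnj s)"
  by (simp add: G_def Conj_smul Conj_Res slice_restrict_cnj S_def)

lemma Riesz_Dunford_integrand_eq:
  "s \<in> S \<Longrightarrow> Riesz_Dunford_integrand i fi T s ds = smul ds (G s)"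
  by (simp add: Riesz_Dunford_integrand_def inverse_in_Delta S_def G_def smul_smul mult.commute flip: smul_eq)

text \<open>Writing an operator as \<open>a + b i\<close> with \<open>Conj\<close>-invariant \<open>a\<close> and \<open>b\<close>, where \<open>i\<close> acts by right
  multiplication on vectors, the following map sends it to \<open>b - a i\<close> with \<open>i\<close> now acting by left
  multiplication.\<close>

definition right_to_left :: "('x \<Rightarrow>\<^sub>L 'x) \<Rightarrow> ('x \<Rightarrow>\<^sub>L 'x)" where
  "right_to_left V = (-1/2) *\<^sub>R (right_mult i o\<^sub>L (V - Conj V)) - (1/2) *\<^sub>R ((V + Conj V) o\<^sub>L left_mult i)"

lemma bounded_linear_right_to_left: "bounded_linear right_to_left"
  unfolding right_to_left_def
  by (intro bounded_linear_sub bounded_linear_add bounded_linear_ident bounded_linear_Conj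
        bounded_linear_const_scaleR
        bounded_linear_compose [OF bounded_bilinear.bounded_linear_left [OF bounded_bilinear_blinfun_compose]]
        bounded_linear_compose [OF bounded_bilinear.bounded_linear_right [OF bounded_bilinear_blinfun_compose]])

lemma smul_Res_apply:
  assumes "s \<in> \<Omega>"
  shows "smul c (Res s) x = Qinv s (Re (cnj s * c) *\<^sub>R x + Im (cnj s * c) *\<^sub>R (x \<star>\<^sub>r i))
    - Qinv s (Re c *\<^sub>R T x + Im c *\<^sub>R (T x \<star>\<^sub>r i))"
proof -
  have "x \<star>\<^sub>r emb (cnj s) \<star>\<^sub>r emb c = x \<star>\<^sub>r emb (cnj s * c)"
    by (simp only: rscale_mult slice_embed_mult [OF i])
  then have "smul c (Res s) x = Qinv s (x \<star>\<^sub>r emb (cnj s * c)) - Qinv s (T x \<star>\<^sub>r emb c)"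
    by (simp only: smul_apply Res_apply rscale_diff_left Qinv_rscale [OF assms, symmetric])
  then show ?thesis by (simp only: rscale_slice_embed)
qed

lemma right_to_left_smul_Res:
  assumes s: "s \<in> \<Omega>"
  shows "right_to_left (smul c (Res s)) = left_S_resolvent (emb s) T o\<^sub>L left_mult (emb (- \<i> * c))"
proof (rule blinfun_eqI)
  fix x
  let ?Q = "blinfun_apply (Qinv s)"
  have cs: "cnj s \<in> \<Omega>" using s by (simp add: cnj_\<Omega>)
  define p q where "p = Re (cnj s * c)" and "q = Im (cnj s * c)"
  have pq: "Re (s * cnj c) = p" "Im (s * cnj c) = - q"
    by (simp_all add: p_def q_def)
  have V: "smul c (Res s) x = p *\<^sub>R ?Q x + q *\<^sub>R ?Q (x \<star>\<^sub>r i) - Re c *\<^sub>R ?Q (T x) - Im c *\<^sub>R ?Q (T x \<star>\<^sub>r i)" for x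
    by (simp add: smul_Res_apply [OF s] p_def [symmetric] q_def [symmetric] blinfun.add_right blinfun.scaleR_right
         del: times_complex.sel complex_cnj)
  \<comment> \<open>\<open>Conj\<close> replaces \<open>s\<close> and \<open>c\<close> by their
    conjugates: \<open>p\<close> and \<open>Re c\<close> stay, \<open>q\<close> and
    \<open>Im c\<close> change sign.\<close>
  have CV: "Conj (smul c (Res s)) x = p *\<^sub>R ?Q x - q *\<^sub>R ?Q (x \<star>\<^sub>r i) - Re c *\<^sub>R ?Q (T x) + Im c *\<^sub>R ?Q (T x \<star>\<^sub>r i)" for x
    by (simp add: Conj_smul Conj_Res [OF s] smul_Res_apply [OF cs] pq Qinv_cnj blinfun.add_right blinfun.scaleR_right
         blinfun.diff_right del: times_complex.sel)
  have ii: "y \<star>\<^sub>r i \<star>\<^sub>r i = - y" for y :: 'x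
    by (simp add: imag_unit_square [OF i] rscale_1 rscale_scaleR [of y "-1" 1, simplified] flip: rscale_mult)
  have "right_to_left (smul c (Res s)) x
      = q *\<^sub>R ?Q x - Im c *\<^sub>R ?Q (T x) - p *\<^sub>R ?Q (i \<star>\<^sub>l x) + Re c *\<^sub>R ?Q (T (i \<star>\<^sub>l x))"
    by (simp add: right_to_left_def blinfun.diff_left blinfun.add_left blinfun.scaleR_left V CV right_mult_eq left_mult_eq blinfun.minus_left
       Qinv_rscale [OF s] blinfun_rscale_scaleR rscale_diff_left ii algebra_simps flip: scaleR_left_distrib)
  also have "\<dots> = (left_S_resolvent (emb s) T o\<^sub>L left_mult (emb (- \<i> * c))) x"
  proof -
    have L: "emb (cnj s) \<star>\<^sub>l emb (- \<i> * c) \<star>\<^sub>l x = emb (- \<i> * (cnj s * c)) \<star>\<^sub>l x"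
    proof -
      have "- \<i> * (cnj s * c) = cnj s * (- \<i> * c)" by simp
      then show ?thesis by (simp only: slice_embed_mult [OF i] lscale_mult)
    qed
    have "emb (- \<i> * (cnj s * c)) \<star>\<^sub>l x = q *\<^sub>R x - p *\<^sub>R (i \<star>\<^sub>l x)"
    proof -
      have "Re (- \<i> * (cnj s * c)) = q" "Im (- \<i> * (cnj s * c)) = - p"
        by (simp_all add: p_def q_def)
      then show ?thesis by (simp only: lscale_slice_embed) simp
    qed
    moreover have "emb (- \<i> * c) \<star>\<^sub>l x = Im c *\<^sub>R x - Re c *\<^sub>R (i \<star>\<^sub>l x)"
      unfolding lscale_slice_embed by simp
    moreover have "(left_S_resolvent (emb s) T o\<^sub>L left_mult (emb (- \<i> * c))) x
        = ?Q (emb (cnj s) \<star>\<^sub>l emb (- \<i> * c) \<star>\<^sub>l x) - ?Q (T (emb (- \<i> * c) \<star>\<^sub>l x))"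
      by (simp add: left_S_resolvent_def slice_embed_components [OF i] Qinv_def [symmetric] left_mult_eq
          blinfun.minus_left blinfun.diff_left blinfun.diff_right)
    ultimately show ?thesis
      unfolding L by (simp only: blinfun.diff_right blinfun.scaleR_right) simp
  qed
  finally show "right_to_left (smul c (Res s)) x = (left_S_resolvent (emb s) T o\<^sub>L left_mult (emb (- \<i> * c))) x" .
qed

text \<open>The scalars \<open>- i\<close>, \<open>emb ds\<close> and \<open>f (emb s)\<close> all
  lie in the plane of \<open>i\<close>, so they commute and merge into one left
  multiplication.\<close>

lemma S_integrand_eq:
  assumes "s \<in> S"
  shows "S_integrand i f T s ds = right_to_left (smul ds (G s))"
proof -
  have "- i * emb ds * f (emb s) = emb (- \<i> * (fi s * ds))"
  proof -
    have "- i * emb ds * f (emb s) = emb (- \<i>) * emb ds * emb (fi s)"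
      using assms by (simp add: S_def slice_embed_slice_restrict slice_embed_uminus slice_embed_ii)
    also have "\<dots> = emb (- \<i> * ds * fi s)"
      by (simp only: slice_embed_mult [OF i])
    also have "- \<i> * ds * fi s = - \<i> * (fi s * ds)" by simp
    finally show ?thesis .
  qed
  moreover have "V \<diamondop>\<^sub>r p \<diamondop>\<^sub>r q = V \<diamondop>\<^sub>r (p * q)" for V :: "'x \<Rightarrow>\<^sub>L 'x" and p q
    by (rule blinfun_eqI) (simp add: op_rscale_def left_mult_eq lscale_mult)
  ultimately show ?thesis
    using assms right_to_left_smul_Res [of s "fi s * ds"]
    by (simp add: S_integrand_def op_rscale_def G_def smul_smul S_def mult.commute)
qed

section \<open>Integrals along the boundary curves\<close>

lemma integrable_G:
  assumes "valid_path g" "path_image g \<subseteq> S"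
  shows "(\<lambda>t. smul (vector_derivative g (at t within {0..1})) (G (g t))) integrable_on {0..1}"
  using integrable_along_path [OF open_S assms G_has_derivative continuous_on_G'] .

definition I where "I g = integral {0..1} (\<lambda>t. smul (vector_derivative g (at t within {0..1})) (G (g t)))"

lemma has_integral_I:
  assumes "valid_path g" "path_image g \<subseteq> S"
  shows "((\<lambda>t. smul (vector_derivative g (at t within {0..1})) (G (g t))) has_integral I g) {0..1}"
  unfolding I_def by (intro integrable_integral integrable_G assms)

lemma Riesz_Dunford_has_integral:
  assumes "valid_path g" "path_image g \<subseteq> S"
  shows "((\<lambda>t. Riesz_Dunford_integrand i fi T (g t) (vector_derivative g (at t within {0..1}))) has_integral I g) {0..1}"
  using has_integral_I [OF assms] assms(2)
  by (elim has_integral_eq [rotated]) (auto simp: Riesz_Dunford_integrand_eq path_image_def image_subset_iff)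

lemma S_has_integral:
  assumes "valid_path g" "path_image g \<subseteq> S"
  shows "((\<lambda>t. S_integrand i f T (g t) (vector_derivative g (at t within {0..1}))) has_integral right_to_left (I g)) {0..1}"
  using has_integral_linear [OF has_integral_I [OF assms] bounded_linear_right_to_left] assms(2)
  by (elim has_integral_eq [rotated]) (auto simp: S_integrand_eq path_image_def image_subset_iff)

lemma cfun_I:
  assumes "valid_path g" "path_image g \<subseteq> S"
  shows "contour_integral g (\<lambda>s. cfun \<phi> (G s)) = cfun \<phi> (I g)"
    and "contour_integral (cnj \<circ> g) (\<lambda>s. cfun \<phi> (G s)) = cfun \<phi> (Conj (I g))"
proof -
  show "contour_integral g (\<lambda>s. cfun \<phi> (G s)) = cfun \<phi> (I g)"
    unfolding I_def by (intro cfun_integral_along_path [symmetric] integrable_G assms)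
  \<comment> \<open>The antilinear maps \<open>cnj\<close> and \<open>Conj\<close> around
    \<open>cfun\<close> compose to a complex linear map, so the derivative of the path comes out
    unconjugated.\<close>
  have "bounded_linear (\<lambda>V. cnj (cfun \<phi> (Conj V)))"
    by (intro bounded_linear_compose [OF bounded_linear_cnj] bounded_linear_compose [OF bounded_linear_cfun] bounded_linear_Conj)
  from has_integral_linear [OF has_integral_I [OF assms] this]
  have "((\<lambda>t. cnj (cfun \<phi> (G (cnj (g t)))) * vector_derivative g (at t within {0..1})) has_integral
      cnj (cfun \<phi> (Conj (I g)))) {0..1}"
  proof (rule has_integral_eq [rotated])
    fix t :: real assume "t \<in> {0..1}"
    then have "g t \<in> S" using assms(2) by (auto simp: path_image_def)
    then show "((\<lambda>V. cnj (cfun \<phi> (Conj V))) \<circ> (\<lambda>t. smul (vector_derivative g (at t within {0..1})) (G (g t)))) t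
        = cnj (cfun \<phi> (G (cnj (g t)))) * vector_derivative g (at t within {0..1})"
      by (simp add: Conj_smul Conj_G cfun_smul)
  qed
  then have "contour_integral g (cnj \<circ> (\<lambda>s. cfun \<phi> (G s)) \<circ> cnj) = cnj (cfun \<phi> (Conj (I g)))"
    by (intro contour_integral_unique) (simp add: has_contour_integral_def)
  then show "contour_integral (cnj \<circ> g) (\<lambda>s. cfun \<phi> (G s)) = cfun \<phi> (Conj (I g))"
    by (simp add: contour_integral_cnj [OF assms(1)])
qed

text \<open>The cycle together with its complex conjugate is null-homologous in \<open>S\<close>, since conjugation
  reverses orientation.\<close>

lemma Conj_integral:
  assumes gs: "\<And>g. g \<in> set gs \<Longrightarrow> valid_path g \<and> pathfinish g = pathstart g \<and> path_image g \<subseteq> S"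
    and wn: "\<And>z. z \<notin> S \<Longrightarrow> (\<Sum>g\<leftarrow>gs. winding_number g z) = cnj (\<Sum>g\<leftarrow>gs. winding_number g (cnj z))"
  shows "Conj (\<Sum>g\<leftarrow>gs. I g) = - (\<Sum>g\<leftarrow>gs. I g)"
proof -
  have "(\<Sum>g\<leftarrow>gs. I g) + Conj (\<Sum>g\<leftarrow>gs. I g) = 0"
  \<comment> \<open>Functionals reduce the claim to the scalar Cauchy theorem for the curves
    together with their conjugates.\<close>
  proof (rule eq_0_if_cfun_eq_0)
    fix \<phi> :: "('x \<Rightarrow>\<^sub>L 'x) \<Rightarrow>\<^sub>L real"
    have "(\<Sum>g\<leftarrow>gs @ map ((\<circ>) cnj) gs. contour_integral g (\<lambda>s. cfun \<phi> (G s))) = 0"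
    proof (rule Cauchy_theorem_cycle [OF open_S])
      show "(\<lambda>s. cfun \<phi> (G s)) holomorphic_on S"
        by (rule holomorphic_on_cfun [OF open_S G_has_derivative])
      show "valid_path g \<and> pathfinish g = pathstart g \<and> path_image g \<subseteq> S"
        if "g \<in> set (gs @ map ((\<circ>) cnj) gs)" for g
        using that gs cnj_S
        by (fastforce simp: valid_path_cnj pathfinish_compose pathstart_compose path_image_compose)
    next
      fix z assume z: "z \<notin> S"
      have "winding_number (cnj \<circ> g) z = - cnj (winding_number g (cnj z))" if "g \<in> set gs" for g
      proof -
        have "cnj z \<notin> path_image g" using gs [OF that] z cnj_S by blast
        then show ?thesis
          using winding_number_cnj [of g "cnj z"] gs [OF that] by (simp add: valid_path_imp_path)
      qed
      then have "(\<Sum>g\<leftarrow>map ((\<circ>) cnj) gs. winding_number g z) = (\<Sum>g\<leftarrow>gs. - cnj (winding_number g (cnj z)))"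
        by (simp add: o_def cong: map_cong)
      also have "\<dots> = - cnj (\<Sum>g\<leftarrow>gs. winding_number g (cnj z))"
        using sum_list_bounded_linear [OF bounded_linear_minus [OF bounded_linear_cnj]] by metis
      finally show "(\<Sum>g\<leftarrow>gs @ map ((\<circ>) cnj) gs. winding_number g z) = 0"
        using wn [OF z] by simp
    qed
    moreover have "map (\<lambda>g. contour_integral g (\<lambda>s. cfun \<phi> (G s))) gs = map (\<lambda>g. cfun \<phi> (I g)) gs"
      using gs by (simp add: cfun_I(1))
    moreover have "map (\<lambda>g. contour_integral g (\<lambda>s. cfun \<phi> (G s))) (map ((\<circ>) cnj) gs)
        = map (\<lambda>g. cfun \<phi> (Conj (I g))) gs"
      using gs by (simp add: cfun_I(2))
    ultimately have "(\<Sum>g\<leftarrow>gs. cfun \<phi> (I g)) + (\<Sum>g\<leftarrow>gs. cfun \<phi> (Conj (I g))) = 0"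
      by (simp only: map_append sum_list.append)
    then show "cfun \<phi> ((\<Sum>g\<leftarrow>gs. I g) + Conj (\<Sum>g\<leftarrow>gs. I g)) = 0"
      by (simp add: sum_list_bounded_linear [OF bounded_linear_Conj] sum_list_bounded_linear [OF bounded_linear_cfun]
          bounded_linear.linear [OF bounded_linear_cfun, THEN linear_add])
  qed
  then show ?thesis by (simp add: eq_neg_iff_add_eq_0 add.commute)
qed

end

theorem proposition4p4:
  fixes T :: "'x :: two_sided_quat_banach \<Rightarrow>\<^sub>L 'x"
    and i :: quat
    and D U :: "quat set"
    and f :: "quat \<Rightarrow> quat"
    and gs :: "(real \<Rightarrow> complex) list"
  assumes "T \<in> B_R"
    and "i \<in> imag_units"
    and "slice_cauchy_domain D" and "bounded D"
    and "S_spectrum T \<subseteq> D"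
    and "intrinsic_slice_hyperholomorphic_on U f"
    and "closure D \<subseteq> U"
    and "positively_oriented_boundary (slice_embed i -` D) gs"
  shows "boundary_integrable gs (S_integrand i f T) \<and>
    boundary_integrable gs (Riesz_Dunford_integrand i (slice_restrict i f) T) \<and>
    S_calculus i gs f T = Riesz_Dunford_calculus i gs (slice_restrict i f) T"
proof -
  obtain j where "j \<in> imag_units" "j * i = - (i * j)"
    using anticommuting_imag_unit [OF assms(2)] .
  then interpret slice_calculus T i j U f
    using assms by unfold_locales
  define A where "A = emb -` D"
  have "open A"
    unfolding A_def using assms(3) open_vimage [OF _ continuous_on_slice_embed]
    by (auto simp: slice_cauchy_domain_def)
  have closA: "closure A \<subseteq> emb -` U"
  proof -
    have "closed (emb -` closure D)"
      by (intro closed_vimage closed_closure continuous_on_slice_embed)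
    then have "closure A \<subseteq> emb -` closure D"
      unfolding A_def by (intro closure_minimal vimage_mono closure_subset)
    then show ?thesis using assms(7) by blast
  qed
  have not\<Omega>: "z \<in> A" if "z \<notin> \<Omega>" for z
    using that assms(5) by (auto simp: A_def \<Omega>_def S_spectrum_def)
  have pos: "positively_oriented_boundary A gs" using assms(8) by (simp add: A_def)
  \<comment> \<open>A frontier point is in the closure of \<open>A\<close>, hence in the slice of
    \<open>U\<close>, and it is not in the open set \<open>A\<close>, which contains all points
    outside \<Omega>.\<close>
  have frA: "frontier A \<subseteq> S"
    using closA not\<Omega> by (auto simp: S_def frontier_def interior_open [OF \<open>open A\<close>])
  have gs: "valid_path g \<and> pathfinish g = pathstart g \<and> path_image g \<subseteq> S" if "g \<in> set gs" for g
    using pos that frA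
    by (auto simp: positively_oriented_boundary_def is_boundary_system_def jordan_system_def)
  \<comment> \<open>Points outside \<Omega> lie in \<open>A\<close>; the other points outside
    \<open>S\<close> miss the slice of \<open>U\<close> and so the closure of \<open>A\<close>. The
    resulting value is real and invariant under conjugation, as \<open>Conj_integral\<close>
    requires.\<close>
  have wn: "(\<Sum>g\<leftarrow>gs. winding_number g z) = (if z \<in> \<Omega> then 0 else 1)" if "z \<notin> S" for z
    using pos that not\<Omega> closA by (auto simp: positively_oriented_boundary_def S_def)
  have Conj: "Conj (\<Sum>g\<leftarrow>gs. I g) = - (\<Sum>g\<leftarrow>gs. I g)"
    by (rule Conj_integral) (use gs wn cnj_S cnj_\<Omega> in auto)
  have "boundary_integrable gs (S_integrand i f T)"
    unfolding boundary_integrable_def using S_has_integral gs by blast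
  moreover have "boundary_integrable gs (Riesz_Dunford_integrand i fi T)"
    unfolding boundary_integrable_def using Riesz_Dunford_has_integral gs by blast
  moreover have "S_calculus i gs f T = Riesz_Dunford_calculus i gs fi T"
  proof -
    let ?I = "\<Sum>g\<leftarrow>gs. I g"
    have "boundary_integral gs (S_integrand i f T) = (\<Sum>g\<leftarrow>gs. right_to_left (I g))"
      unfolding boundary_integral_def
      by (intro arg_cong [where f = sum_list] map_cong refl integral_unique S_has_integral) (use gs in auto)
    also have "\<dots> = right_to_left ?I"
      by (rule sum_list_bounded_linear [OF bounded_linear_right_to_left, symmetric])
    \<comment> \<open>As \<open>?I + Conj ?I\<close> vanishes, the term with left multiplication
      drops out of \<open>right_to_left\<close>.\<close>
    also have "\<dots> = - (right_mult i o\<^sub>L ?I)"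
      by (rule blinfun_eqI)
         (simp add: right_to_left_def Conj blinfun.diff_left blinfun.add_left blinfun.minus_left blinfun.scaleR_left
            blinfun.add_right blinfun.scaleR_right blinfun.zero_left flip: scaleR_2)
    finally have S: "boundary_integral gs (S_integrand i f T) = - (right_mult i o\<^sub>L ?I)" .
    have RD: "boundary_integral gs (Riesz_Dunford_integrand i fi T) = ?I"
      unfolding boundary_integral_def
      by (intro arg_cong [where f = sum_list] map_cong refl integral_unique Riesz_Dunford_has_integral) (use gs in auto)
    \<comment> \<open>The factor \<open>- \<i>\<close> in this constant matches the one that
      \<open>right_to_left\<close> produced.\<close>
    have "1 / (2 * of_real pi * \<i>) = of_real (1 / (2 * pi)) * (- \<i>)"
      by (simp add: field_simps)
    then have "slice_op_scale i (1 / (2 * of_real pi * \<i>)) ?I = (1 / (2 * pi)) *\<^sub>R smul (- \<i>) ?I"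
      by (metis smul_eq smul_of_real smul_smul)
    also have "smul (- \<i>) ?I = - (right_mult i o\<^sub>L ?I)"
      by (simp add: smul_def post_right_mult_apply)
    finally show ?thesis
      by (simp add: S_calculus_def Riesz_Dunford_calculus_def S RD)
  qed
  ultimately show ?thesis by blast
qed

end
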